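(* Let $T$ be a theory in the language of category theory plus constants, $\Gamma$ a context, $\Delta$ a context extending $\Gamma$, $\Delta_1,\Delta_2$ copies of $\Delta$ obtained by renaming its variables, and $P(\Delta)$ a formula in context $(\Gamma,\Delta)$. Then $T$ proves that for every context isomorphism $\tau:\Delta_1\cong\Delta_2$, $P(\Delta_1)\leftrightarrow P(\Delta_2)$.
   Context: The language of category theory is a dependently sorted first-order language (intuitionistic logic) with a sort of objects and, for object-terms $X,Y$, a sort of arrows $X\to Y$, identity arrow-terms $1_X$, composition $g\circ f$, and atomic formulas $f=g$ only for arrow-terms of the same sort (no equality of objects). Constants: object constants and arrow constants between object constants. Theories contain the category axioms and axioms that $=$ is an equivalence relation preserved by composition. A context is a list of distinct typed variables in which each arrow variable's source and target are constants or earlier variables; $\Delta$ extends $\Gamma$ if the concatenation $(\Gamma,\Delta)$ is a context. For each variable $V$ of $\Delta$, $\Delta_i$ has variable $V_i$ of the correspondingly renamed sort. A context isomorphism $\tau:\Delta_1\cong\Delta_2$ is, for each object variable $V$ of $\Delta$, an arrow $f_V:V_1\to V_2$ (setting $f_S:=1_S$ for object-terms $S$ in context $\Gamma$) such that each $f_V$ is an isomorphism and for every arrow variable $g:A\to B$ of $\Delta$, $g_2\circ f_A=f_B\circ g_1$; this is expressible as a finite conjunction. *)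

theory Defs
  imports Main
begin

section \<open>Syntax\<close>

text \<open>
  The syntax is locally nameless: free variables carry names (so contexts are lists of named
  variables), bound variables are de Bruijn indices. Object variables and arrow variables live in
  separate name spaces, and their bound indices are counted separately: \<open>OBnd k\<close> refers to the
  \<open>k\<close>-th enclosing object quantifier, \<open>ABnd k\<close> to the \<open>k\<close>-th enclosing arrow quantifier.
\<close>

text \<open>The constants are carved out of types by sets, so that there may be none at all.\<close>

record ('c, 'a) lang =
  obj_consts :: "'c set"
  arr_consts :: "'a set"
  src :: "'a \<Rightarrow> 'c"
  tgt :: "'a \<Rightarrow> 'c"

definition wf_lang :: "('c, 'a) lang \<Rightarrow> bool" where
  "wf_lang L \<longleftrightarrow> (\<forall>a \<in> arr_consts L. src L a \<in> obj_consts L \<and> tgt L a \<in> obj_consts L)"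

datatype 'c obj = OCon 'c | OVar nat | OBnd nat

text \<open>\<open>Comp g f\<close> is the composite of \<open>f\<close> followed by \<open>g\<close>.\<close>

datatype ('c, 'a) arr =
    ACon 'a
  | AVar nat
  | ABnd nat
  | Ident "'c obj"
  | Comp "('c, 'a) arr" "('c, 'a) arr"

text \<open>\<open>AllA A B P\<close> and \<open>ExA A B P\<close> quantify over arrows from \<open>A\<close> to \<open>B\<close>.\<close>

datatype ('c, 'a) fm =
    Eq "('c, 'a) arr" "('c, 'a) arr"
  | Bot
  | And "('c, 'a) fm" "('c, 'a) fm"
  | Or "('c, 'a) fm" "('c, 'a) fm"
  | Imp "('c, 'a) fm" "('c, 'a) fm"
  | AllO "('c, 'a) fm"
  | AllA "'c obj" "'c obj" "('c, 'a) fm"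
  | ExO "('c, 'a) fm"
  | ExA "'c obj" "'c obj" "('c, 'a) fm"

definition Top :: "('c, 'a) fm" where
  "Top = Imp Bot Bot"

definition Iff :: "('c, 'a) fm \<Rightarrow> ('c, 'a) fm \<Rightarrow> ('c, 'a) fm" where
  "Iff P Q = And (Imp P Q) (Imp Q P)"

definition Conj :: "('c, 'a) fm list \<Rightarrow> ('c, 'a) fm" where
  "Conj Ps = foldr And Ps Top"


subsection \<open>Instantiating a bound variable by a term\<close>

primrec oopen_obj :: "nat \<Rightarrow> 'c obj \<Rightarrow> 'c obj \<Rightarrow> 'c obj" where
  "oopen_obj k U (OCon c) = OCon c"
| "oopen_obj k U (OVar x) = OVar x"
| "oopen_obj k U (OBnd i) = (if i = k then U else OBnd i)"

primrec oopen_arr :: "nat \<Rightarrow> 'c obj \<Rightarrow> ('c, 'a) arr \<Rightarrow> ('c, 'a) arr" where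
  "oopen_arr k U (ACon a) = ACon a"
| "oopen_arr k U (AVar f) = AVar f"
| "oopen_arr k U (ABnd i) = ABnd i"
| "oopen_arr k U (Ident A) = Ident (oopen_obj k U A)"
| "oopen_arr k U (Comp s t) = Comp (oopen_arr k U s) (oopen_arr k U t)"

primrec oopen :: "nat \<Rightarrow> 'c obj \<Rightarrow> ('c, 'a) fm \<Rightarrow> ('c, 'a) fm" where
  "oopen k U (Eq s t) = Eq (oopen_arr k U s) (oopen_arr k U t)"
| "oopen k U Bot = Bot"
| "oopen k U (And P Q) = And (oopen k U P) (oopen k U Q)"
| "oopen k U (Or P Q) = Or (oopen k U P) (oopen k U Q)"
| "oopen k U (Imp P Q) = Imp (oopen k U P) (oopen k U Q)"
| "oopen k U (AllO P) = AllO (oopen (Suc k) U P)"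
| "oopen k U (AllA A B P) = AllA (oopen_obj k U A) (oopen_obj k U B) (oopen k U P)"
| "oopen k U (ExO P) = ExO (oopen (Suc k) U P)"
| "oopen k U (ExA A B P) = ExA (oopen_obj k U A) (oopen_obj k U B) (oopen k U P)"

primrec aopen_arr :: "nat \<Rightarrow> ('c, 'a) arr \<Rightarrow> ('c, 'a) arr \<Rightarrow> ('c, 'a) arr" where
  "aopen_arr k u (ACon a) = ACon a"
| "aopen_arr k u (AVar f) = AVar f"
| "aopen_arr k u (ABnd i) = (if i = k then u else ABnd i)"
| "aopen_arr k u (Ident A) = Ident A"
| "aopen_arr k u (Comp s t) = Comp (aopen_arr k u s) (aopen_arr k u t)"

primrec aopen :: "nat \<Rightarrow> ('c, 'a) arr \<Rightarrow> ('c, 'a) fm \<Rightarrow> ('c, 'a) fm" where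
  "aopen k u (Eq s t) = Eq (aopen_arr k u s) (aopen_arr k u t)"
| "aopen k u Bot = Bot"
| "aopen k u (And P Q) = And (aopen k u P) (aopen k u Q)"
| "aopen k u (Or P Q) = Or (aopen k u P) (aopen k u Q)"
| "aopen k u (Imp P Q) = Imp (aopen k u P) (aopen k u Q)"
| "aopen k u (AllO P) = AllO (aopen k u P)"
| "aopen k u (AllA A B P) = AllA A B (aopen (Suc k) u P)"
| "aopen k u (ExO P) = ExO (aopen k u P)"
| "aopen k u (ExA A B P) = ExA A B (aopen (Suc k) u P)"


subsection \<open>Binding a free variable\<close>

primrec oclose_obj :: "nat \<Rightarrow> nat \<Rightarrow> 'c obj \<Rightarrow> 'c obj" where
  "oclose_obj k x (OCon c) = OCon c"
| "oclose_obj k x (OVar y) = (if y = x then OBnd k else OVar y)"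
| "oclose_obj k x (OBnd i) = OBnd i"

primrec oclose_arr :: "nat \<Rightarrow> nat \<Rightarrow> ('c, 'a) arr \<Rightarrow> ('c, 'a) arr" where
  "oclose_arr k x (ACon a) = ACon a"
| "oclose_arr k x (AVar f) = AVar f"
| "oclose_arr k x (ABnd i) = ABnd i"
| "oclose_arr k x (Ident A) = Ident (oclose_obj k x A)"
| "oclose_arr k x (Comp s t) = Comp (oclose_arr k x s) (oclose_arr k x t)"

primrec oclose :: "nat \<Rightarrow> nat \<Rightarrow> ('c, 'a) fm \<Rightarrow> ('c, 'a) fm" where
  "oclose k x (Eq s t) = Eq (oclose_arr k x s) (oclose_arr k x t)"
| "oclose k x Bot = Bot"
| "oclose k x (And P Q) = And (oclose k x P) (oclose k x Q)"
| "oclose k x (Or P Q) = Or (oclose k x P) (oclose k x Q)"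
| "oclose k x (Imp P Q) = Imp (oclose k x P) (oclose k x Q)"
| "oclose k x (AllO P) = AllO (oclose (Suc k) x P)"
| "oclose k x (AllA A B P) = AllA (oclose_obj k x A) (oclose_obj k x B) (oclose k x P)"
| "oclose k x (ExO P) = ExO (oclose (Suc k) x P)"
| "oclose k x (ExA A B P) = ExA (oclose_obj k x A) (oclose_obj k x B) (oclose k x P)"

primrec aclose_arr :: "nat \<Rightarrow> nat \<Rightarrow> ('c, 'a) arr \<Rightarrow> ('c, 'a) arr" where
  "aclose_arr k f (ACon a) = ACon a"
| "aclose_arr k f (AVar g) = (if g = f then ABnd k else AVar g)"
| "aclose_arr k f (ABnd i) = ABnd i"
| "aclose_arr k f (Ident A) = Ident A"
| "aclose_arr k f (Comp s t) = Comp (aclose_arr k f s) (aclose_arr k f t)"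

primrec aclose :: "nat \<Rightarrow> nat \<Rightarrow> ('c, 'a) fm \<Rightarrow> ('c, 'a) fm" where
  "aclose k f (Eq s t) = Eq (aclose_arr k f s) (aclose_arr k f t)"
| "aclose k f Bot = Bot"
| "aclose k f (And P Q) = And (aclose k f P) (aclose k f Q)"
| "aclose k f (Or P Q) = Or (aclose k f P) (aclose k f Q)"
| "aclose k f (Imp P Q) = Imp (aclose k f P) (aclose k f Q)"
| "aclose k f (AllO P) = AllO (aclose k f P)"
| "aclose k f (AllA A B P) = AllA A B (aclose (Suc k) f P)"
| "aclose k f (ExO P) = ExO (aclose k f P)"
| "aclose k f (ExA A B P) = ExA A B (aclose (Suc k) f P)"


section \<open>Contexts and well-sortedness\<close>

text \<open>\<open>Obj x\<close> declares the object variable \<open>OVar x\<close>; \<open>Arr f A B\<close> declares \<open>AVar f\<close> of sort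
  \<open>A \<rightarrow> B\<close>. Later declarations stand further to the right.\<close>

datatype 'c decl = Obj nat | Arr nat "'c obj" "'c obj"

type_synonym 'c ctx = "'c decl list"

definition ovars :: "'c ctx \<Rightarrow> nat set" where
  "ovars \<Gamma> = {x. Obj x \<in> set \<Gamma>}"

definition avars :: "'c ctx \<Rightarrow> nat set" where
  "avars \<Gamma> = {f. \<exists>A B. Arr f A B \<in> set \<Gamma>}"

inductive obj_in :: "('c, 'a) lang \<Rightarrow> 'c ctx \<Rightarrow> 'c obj \<Rightarrow> bool" for L \<Gamma> where
  OCon: "c \<in> obj_consts L \<Longrightarrow> obj_in L \<Gamma> (OCon c)"
| OVar: "x \<in> ovars \<Gamma> \<Longrightarrow> obj_in L \<Gamma> (OVar x)"

inductive is_ctx :: "('c, 'a) lang \<Rightarrow> 'c ctx \<Rightarrow> bool" for L where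
  Nil: "is_ctx L []"
| Obj: "is_ctx L \<Gamma> \<Longrightarrow> x \<notin> ovars \<Gamma> \<Longrightarrow> is_ctx L (\<Gamma> @ [Obj x])"
| Arr: "is_ctx L \<Gamma> \<Longrightarrow> obj_in L \<Gamma> A \<Longrightarrow> obj_in L \<Gamma> B \<Longrightarrow> f \<notin> avars \<Gamma>
    \<Longrightarrow> is_ctx L (\<Gamma> @ [Arr f A B])"

inductive arr_in ::
  "('c, 'a) lang \<Rightarrow> 'c ctx \<Rightarrow> ('c, 'a) arr \<Rightarrow> 'c obj \<Rightarrow> 'c obj \<Rightarrow> bool" for L \<Gamma> where
  ACon: "a \<in> arr_consts L \<Longrightarrow> arr_in L \<Gamma> (ACon a) (OCon (src L a)) (OCon (tgt L a))"
| AVar: "Arr f A B \<in> set \<Gamma> \<Longrightarrow> arr_in L \<Gamma> (AVar f) A B"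
| Ident: "obj_in L \<Gamma> A \<Longrightarrow> arr_in L \<Gamma> (Ident A) A A"
| Comp: "arr_in L \<Gamma> s A B \<Longrightarrow> arr_in L \<Gamma> t B C \<Longrightarrow> arr_in L \<Gamma> (Comp t s) A C"

text \<open>In the quantifier rules the body is required to be well-formed for every fresh name; since
  there are infinitely many names, this also excludes undeclared free variables from the body.\<close>

inductive fm_in :: "('c, 'a) lang \<Rightarrow> 'c ctx \<Rightarrow> ('c, 'a) fm \<Rightarrow> bool" for L where
  Eq: "arr_in L \<Gamma> s A B \<Longrightarrow> arr_in L \<Gamma> t A B \<Longrightarrow> fm_in L \<Gamma> (Eq s t)"
| Bot: "fm_in L \<Gamma> Bot"
| And: "fm_in L \<Gamma> P \<Longrightarrow> fm_in L \<Gamma> Q \<Longrightarrow> fm_in L \<Gamma> (And P Q)"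
| Or: "fm_in L \<Gamma> P \<Longrightarrow> fm_in L \<Gamma> Q \<Longrightarrow> fm_in L \<Gamma> (Or P Q)"
| Imp: "fm_in L \<Gamma> P \<Longrightarrow> fm_in L \<Gamma> Q \<Longrightarrow> fm_in L \<Gamma> (Imp P Q)"
| AllO: "(\<And>x. x \<notin> ovars \<Gamma> \<Longrightarrow> fm_in L (\<Gamma> @ [Obj x]) (oopen 0 (OVar x) P))
    \<Longrightarrow> fm_in L \<Gamma> (AllO P)"
| AllA: "obj_in L \<Gamma> A \<Longrightarrow> obj_in L \<Gamma> B
    \<Longrightarrow> (\<And>f. f \<notin> avars \<Gamma> \<Longrightarrow> fm_in L (\<Gamma> @ [Arr f A B]) (aopen 0 (AVar f) P))
    \<Longrightarrow> fm_in L \<Gamma> (AllA A B P)"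
| ExO: "(\<And>x. x \<notin> ovars \<Gamma> \<Longrightarrow> fm_in L (\<Gamma> @ [Obj x]) (oopen 0 (OVar x) P))
    \<Longrightarrow> fm_in L \<Gamma> (ExO P)"
| ExA: "obj_in L \<Gamma> A \<Longrightarrow> obj_in L \<Gamma> B
    \<Longrightarrow> (\<And>f. f \<notin> avars \<Gamma> \<Longrightarrow> fm_in L (\<Gamma> @ [Arr f A B]) (aopen 0 (AVar f) P))
    \<Longrightarrow> fm_in L \<Gamma> (ExA A B P)"

text \<open>\<open>all_ctx \<Gamma> P\<close> universally quantifies \<open>P\<close> over all variables of \<open>\<Gamma>\<close>, the first one outermost.\<close>

primrec all_decl :: "'c decl \<Rightarrow> ('c, 'a) fm \<Rightarrow> ('c, 'a) fm" where
  "all_decl (Obj x) P = AllO (oclose 0 x P)"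
| "all_decl (Arr f A B) P = AllA A B (aclose 0 f P)"

definition all_ctx :: "'c ctx \<Rightarrow> ('c, 'a) fm \<Rightarrow> ('c, 'a) fm" where
  "all_ctx \<Gamma> P = foldr all_decl \<Gamma> P"


section \<open>Intuitionistic provability\<close>

text \<open>\<open>prov L T \<Gamma> H P\<close>: in context \<open>\<Gamma>\<close>, the theory \<open>T\<close> proves \<open>P\<close> from the hypotheses \<open>H\<close>. As
  terms must be well-sorted in the current context, no sort is assumed to be inhabited. There are
  no rules for equality; the equality axioms belong to the theories.\<close>

inductive prov ::
  "('c, 'a) lang \<Rightarrow> ('c, 'a) fm set \<Rightarrow> 'c ctx \<Rightarrow> ('c, 'a) fm set \<Rightarrow> ('c, 'a) fm \<Rightarrow> bool"
  for L T where
  Axiom: "is_ctx L \<Gamma> \<Longrightarrow> \<forall>Q \<in> H. fm_in L \<Gamma> Q \<Longrightarrow> P \<in> T \<Longrightarrow> prov L T \<Gamma> H P"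
| Hyp: "is_ctx L \<Gamma> \<Longrightarrow> \<forall>Q \<in> H. fm_in L \<Gamma> Q \<Longrightarrow> P \<in> H \<Longrightarrow> prov L T \<Gamma> H P"
| BotE: "prov L T \<Gamma> H Bot \<Longrightarrow> fm_in L \<Gamma> P \<Longrightarrow> prov L T \<Gamma> H P"
| AndI: "prov L T \<Gamma> H P \<Longrightarrow> prov L T \<Gamma> H Q \<Longrightarrow> prov L T \<Gamma> H (And P Q)"
| AndE1: "prov L T \<Gamma> H (And P Q) \<Longrightarrow> prov L T \<Gamma> H P"
| AndE2: "prov L T \<Gamma> H (And P Q) \<Longrightarrow> prov L T \<Gamma> H Q"
| OrI1: "prov L T \<Gamma> H P \<Longrightarrow> fm_in L \<Gamma> Q \<Longrightarrow> prov L T \<Gamma> H (Or P Q)"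
| OrI2: "prov L T \<Gamma> H Q \<Longrightarrow> fm_in L \<Gamma> P \<Longrightarrow> prov L T \<Gamma> H (Or P Q)"
| OrE: "prov L T \<Gamma> H (Or P Q) \<Longrightarrow> prov L T \<Gamma> (insert P H) R \<Longrightarrow> prov L T \<Gamma> (insert Q H) R
    \<Longrightarrow> prov L T \<Gamma> H R"
| ImpI: "prov L T \<Gamma> (insert P H) Q \<Longrightarrow> prov L T \<Gamma> H (Imp P Q)"
| ImpE: "prov L T \<Gamma> H (Imp P Q) \<Longrightarrow> prov L T \<Gamma> H P \<Longrightarrow> prov L T \<Gamma> H Q"
| AllOI: "x \<notin> ovars \<Gamma> \<Longrightarrow> \<forall>Q \<in> H. fm_in L \<Gamma> Q \<Longrightarrow> fm_in L \<Gamma> (AllO P)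
    \<Longrightarrow> prov L T (\<Gamma> @ [Obj x]) H (oopen 0 (OVar x) P) \<Longrightarrow> prov L T \<Gamma> H (AllO P)"
| AllOE: "prov L T \<Gamma> H (AllO P) \<Longrightarrow> obj_in L \<Gamma> U \<Longrightarrow> prov L T \<Gamma> H (oopen 0 U P)"
| AllAI: "f \<notin> avars \<Gamma> \<Longrightarrow> \<forall>Q \<in> H. fm_in L \<Gamma> Q \<Longrightarrow> fm_in L \<Gamma> (AllA A B P)
    \<Longrightarrow> prov L T (\<Gamma> @ [Arr f A B]) H (aopen 0 (AVar f) P) \<Longrightarrow> prov L T \<Gamma> H (AllA A B P)"
| AllAE: "prov L T \<Gamma> H (AllA A B P) \<Longrightarrow> arr_in L \<Gamma> u A B \<Longrightarrow> prov L T \<Gamma> H (aopen 0 u P)"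
| ExOI: "fm_in L \<Gamma> (ExO P) \<Longrightarrow> obj_in L \<Gamma> U \<Longrightarrow> prov L T \<Gamma> H (oopen 0 U P)
    \<Longrightarrow> prov L T \<Gamma> H (ExO P)"
| ExOE: "prov L T \<Gamma> H (ExO P) \<Longrightarrow> x \<notin> ovars \<Gamma> \<Longrightarrow> fm_in L \<Gamma> R
    \<Longrightarrow> prov L T (\<Gamma> @ [Obj x]) (insert (oopen 0 (OVar x) P) H) R \<Longrightarrow> prov L T \<Gamma> H R"
| ExAI: "fm_in L \<Gamma> (ExA A B P) \<Longrightarrow> arr_in L \<Gamma> u A B \<Longrightarrow> prov L T \<Gamma> H (aopen 0 u P)
    \<Longrightarrow> prov L T \<Gamma> H (ExA A B P)"
| ExAE: "prov L T \<Gamma> H (ExA A B P) \<Longrightarrow> f \<notin> avars \<Gamma> \<Longrightarrow> fm_in L \<Gamma> R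
    \<Longrightarrow> prov L T (\<Gamma> @ [Arr f A B]) (insert (aopen 0 (AVar f) P) H) R \<Longrightarrow> prov L T \<Gamma> H R"

definition proves :: "('c, 'a) lang \<Rightarrow> ('c, 'a) fm set \<Rightarrow> ('c, 'a) fm \<Rightarrow> bool" where
  "proves L T P \<longleftrightarrow> prov L T [] {} P"


section \<open>Theories\<close>

definition eq_axioms :: "('c, 'a) fm set" where
  "eq_axioms =
    (let X = OVar 0; Y = OVar 1; Z = OVar 2;
         f = AVar 0; g = AVar 1; h = AVar 2; k = AVar 3
     in {all_ctx [Obj 0, Obj 1, Arr 0 X Y] (Eq f f),
         all_ctx [Obj 0, Obj 1, Arr 0 X Y, Arr 1 X Y] (Imp (Eq f g) (Eq g f)),
         all_ctx [Obj 0, Obj 1, Arr 0 X Y, Arr 1 X Y, Arr 2 X Y]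
           (Imp (And (Eq f g) (Eq g h)) (Eq f h)),
         all_ctx [Obj 0, Obj 1, Obj 2, Arr 0 X Y, Arr 1 X Y, Arr 2 Y Z, Arr 3 Y Z]
           (Imp (And (Eq f g) (Eq h k)) (Eq (Comp h f) (Comp k g)))})"

definition cat_axioms :: "('c, 'a) fm set" where
  "cat_axioms =
    (let X = OVar 0; Y = OVar 1; Z = OVar 2; W = OVar 3;
         f = AVar 0; g = AVar 1; h = AVar 2
     in {all_ctx [Obj 0, Obj 1, Arr 0 X Y] (Eq (Comp f (Ident X)) f),
         all_ctx [Obj 0, Obj 1, Arr 0 X Y] (Eq (Comp (Ident Y) f) f),
         all_ctx [Obj 0, Obj 1, Obj 2, Obj 3, Arr 0 X Y, Arr 1 Y Z, Arr 2 Z W]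
           (Eq (Comp h (Comp g f)) (Comp (Comp h g) f))})"

definition is_theory :: "('c, 'a) lang \<Rightarrow> ('c, 'a) fm set \<Rightarrow> bool" where
  "is_theory L T \<longleftrightarrow> (\<forall>P \<in> T. fm_in L [] P) \<and> eq_axioms \<subseteq> T \<and> cat_axioms \<subseteq> T"


section \<open>Copies of a context\<close>

primrec rename_obj :: "(nat \<Rightarrow> nat) \<Rightarrow> 'c obj \<Rightarrow> 'c obj" where
  "rename_obj r (OCon c) = OCon c"
| "rename_obj r (OVar x) = OVar (r x)"
| "rename_obj r (OBnd i) = OBnd i"

primrec rename_arr :: "(nat \<Rightarrow> nat) \<Rightarrow> (nat \<Rightarrow> nat) \<Rightarrow> ('c, 'a) arr \<Rightarrow> ('c, 'a) arr" where
  "rename_arr r s (ACon a) = ACon a"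
| "rename_arr r s (AVar f) = AVar (s f)"
| "rename_arr r s (ABnd i) = ABnd i"
| "rename_arr r s (Ident A) = Ident (rename_obj r A)"
| "rename_arr r s (Comp t u) = Comp (rename_arr r s t) (rename_arr r s u)"

primrec rename :: "(nat \<Rightarrow> nat) \<Rightarrow> (nat \<Rightarrow> nat) \<Rightarrow> ('c, 'a) fm \<Rightarrow> ('c, 'a) fm" where
  "rename r s (Eq t u) = Eq (rename_arr r s t) (rename_arr r s u)"
| "rename r s Bot = Bot"
| "rename r s (And P Q) = And (rename r s P) (rename r s Q)"
| "rename r s (Or P Q) = Or (rename r s P) (rename r s Q)"
| "rename r s (Imp P Q) = Imp (rename r s P) (rename r s Q)"
| "rename r s (AllO P) = AllO (rename r s P)"
| "rename r s (AllA A B P) = AllA (rename_obj r A) (rename_obj r B) (rename r s P)"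
| "rename r s (ExO P) = ExO (rename r s P)"
| "rename r s (ExA A B P) = ExA (rename_obj r A) (rename_obj r B) (rename r s P)"

primrec rename_decl :: "(nat \<Rightarrow> nat) \<Rightarrow> (nat \<Rightarrow> nat) \<Rightarrow> 'c decl \<Rightarrow> 'c decl" where
  "rename_decl r s (Obj x) = Obj (r x)"
| "rename_decl r s (Arr f A B) = Arr (s f) (rename_obj r A) (rename_obj r B)"

text \<open>A copy of \<open>\<Delta>\<close> is given by new names \<open>r x\<close>, \<open>s f\<close> for its object and arrow variables; all other
  variables (those of \<open>\<Gamma>\<close>) keep their names.\<close>

definition copy_ctx :: "'c ctx \<Rightarrow> (nat \<Rightarrow> nat) \<Rightarrow> (nat \<Rightarrow> nat) \<Rightarrow> 'c ctx" where
  "copy_ctx \<Delta> r s =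
    map (rename_decl (override_on id r (ovars \<Delta>)) (override_on id s (avars \<Delta>))) \<Delta>"

definition copy_fm ::
  "'c ctx \<Rightarrow> (nat \<Rightarrow> nat) \<Rightarrow> (nat \<Rightarrow> nat) \<Rightarrow> ('c, 'a) fm \<Rightarrow> ('c, 'a) fm" where
  "copy_fm \<Delta> r s P =
    rename (override_on id r (ovars \<Delta>)) (override_on id s (avars \<Delta>)) P"


section \<open>Context isomorphisms\<close>

text \<open>\<open>is_iso t A B\<close> says that \<open>t : A \<rightarrow> B\<close> has a two-sided inverse.\<close>

definition is_iso :: "('c, 'a) arr \<Rightarrow> 'c obj \<Rightarrow> 'c obj \<Rightarrow> ('c, 'a) fm" where
  "is_iso t A B =
    ExA B A (And (Eq (Comp (ABnd 0) t) (Ident A)) (Eq (Comp t (ABnd 0)) (Ident B)))"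

text \<open>For an object variable \<open>V\<close> of \<open>\<Delta>\<close>, the component at \<open>V\<close> of a context isomorphism is the arrow
  variable named \<open>h V\<close>.\<close>

fun iso_decls ::
  "(nat \<Rightarrow> nat) \<Rightarrow> (nat \<Rightarrow> nat) \<Rightarrow> (nat \<Rightarrow> nat) \<Rightarrow> 'c decl \<Rightarrow> 'c ctx" where
  "iso_decls h r1 r2 (Obj V) = [Arr (h V) (OVar (r1 V)) (OVar (r2 V))]"
| "iso_decls h r1 r2 (Arr g A B) = []"

definition iso_ctx ::
  "'c ctx \<Rightarrow> (nat \<Rightarrow> nat) \<Rightarrow> (nat \<Rightarrow> nat) \<Rightarrow> (nat \<Rightarrow> nat) \<Rightarrow> 'c ctx" where
  "iso_ctx \<Delta> h r1 r2 = concat (map (iso_decls h r1 r2) \<Delta>)"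

definition component :: "'c ctx \<Rightarrow> (nat \<Rightarrow> nat) \<Rightarrow> 'c obj \<Rightarrow> ('c, 'a) arr" where
  "component \<Delta> h S =
    (case S of OVar V \<Rightarrow> if V \<in> ovars \<Delta> then AVar (h V) else Ident S | _ \<Rightarrow> Ident S)"

fun iso_condition ::
  "'c ctx \<Rightarrow> (nat \<Rightarrow> nat) \<Rightarrow> (nat \<Rightarrow> nat) \<Rightarrow> (nat \<Rightarrow> nat) \<Rightarrow> (nat \<Rightarrow> nat) \<Rightarrow> (nat \<Rightarrow> nat)
    \<Rightarrow> 'c decl \<Rightarrow> ('c, 'a) fm" where
  "iso_condition \<Delta> h r1 s1 r2 s2 (Obj V) = is_iso (AVar (h V)) (OVar (r1 V)) (OVar (r2 V))"
| "iso_condition \<Delta> h r1 s1 r2 s2 (Arr g A B) =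
    Eq (Comp (AVar (s2 g)) (component \<Delta> h A)) (Comp (component \<Delta> h B) (AVar (s1 g)))"

definition ctx_iso ::
  "'c ctx \<Rightarrow> (nat \<Rightarrow> nat) \<Rightarrow> (nat \<Rightarrow> nat) \<Rightarrow> (nat \<Rightarrow> nat) \<Rightarrow> (nat \<Rightarrow> nat) \<Rightarrow> (nat \<Rightarrow> nat)
    \<Rightarrow> ('c, 'a) fm" where
  "ctx_iso \<Delta> h r1 s1 r2 s2 = Conj (map (iso_condition \<Delta> h r1 s1 r2 s2) \<Delta>)"

end

theory Submission
  imports Defs
begin

text \<open>
  Induct on \<open>P\<close>, for all pairs of interpretations of its context in an ambient context that are linked
  by isomorphisms \<open>f\<^sub>A : A\<^sub>1 \<rightarrow> A\<^sub>2\<close> compatible with the arrow variables. Every arrow-term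
  \<open>t : A \<rightarrow> B\<close> then satisfies \<open>t\<^sub>2 \<circ> f\<^sub>A = f\<^sub>B \<circ> t\<^sub>1\<close>, which settles equations. At an object quantifier both
  interpretations are extended by the same object, linked by its identity. At an arrow quantifier,
  conjugation with \<open>f\<^sub>A\<close> and \<open>f\<^sub>B\<close> matches arrows \<open>A\<^sub>1 \<rightarrow> B\<^sub>1\<close> with arrows \<open>A\<^sub>2 \<rightarrow> B\<^sub>2\<close>. The situation is
  symmetric, so one implication suffices.
\<close>

section \<open>Renaming, opening and closing\<close>

text \<open>Two obstacles shape the proof. The formula \<open>ctx_iso\<close> asserts only that
  inverses exist, whereas conjugation by f_A and f_B needs them as terms; so all inverses are named
  beforehand in an extension of the context, and the induction carries them along. Moreover, a
  conjugated arrow is a composite, while an interpretation sends variables to variables; the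
  composite therefore receives a fresh name, with its defining equation as a hypothesis.
  Interpretations may identify variables and may overlap: \<open>\<Gamma>\<close> is interpreted by
  itself on both sides, and objects bound by quantifiers are shared. Implication is what forces a
  claim about all pairs of interpretations, because its premise travels backwards, along the inverse
  isomorphisms.\<close>

primrec ofv_obj :: "'c obj \<Rightarrow> nat set" where
  "ofv_obj (OCon c) = {}"
| "ofv_obj (OVar x) = {x}"
| "ofv_obj (OBnd i) = {}"

primrec ofv_arr :: "('c, 'a) arr \<Rightarrow> nat set" where
  "ofv_arr (ACon a) = {}"
| "ofv_arr (AVar f) = {}"
| "ofv_arr (ABnd i) = {}"
| "ofv_arr (Ident A) = ofv_obj A"
| "ofv_arr (Comp s t) = ofv_arr s \<union> ofv_arr t"

primrec ofv :: "('c, 'a) fm \<Rightarrow> nat set" where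
  "ofv (Eq s t) = ofv_arr s \<union> ofv_arr t"
| "ofv Bot = {}"
| "ofv (And P Q) = ofv P \<union> ofv Q"
| "ofv (Or P Q) = ofv P \<union> ofv Q"
| "ofv (Imp P Q) = ofv P \<union> ofv Q"
| "ofv (AllO P) = ofv P"
| "ofv (AllA A B P) = ofv_obj A \<union> ofv_obj B \<union> ofv P"
| "ofv (ExO P) = ofv P"
| "ofv (ExA A B P) = ofv_obj A \<union> ofv_obj B \<union> ofv P"

primrec afv_arr :: "('c, 'a) arr \<Rightarrow> nat set" where
  "afv_arr (ACon a) = {}"
| "afv_arr (AVar f) = {f}"
| "afv_arr (ABnd i) = {}"
| "afv_arr (Ident A) = {}"
| "afv_arr (Comp s t) = afv_arr s \<union> afv_arr t"

primrec afv :: "('c, 'a) fm \<Rightarrow> nat set" where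
  "afv (Eq s t) = afv_arr s \<union> afv_arr t"
| "afv Bot = {}"
| "afv (And P Q) = afv P \<union> afv Q"
| "afv (Or P Q) = afv P \<union> afv Q"
| "afv (Imp P Q) = afv P \<union> afv Q"
| "afv (AllO P) = afv P"
| "afv (AllA A B P) = afv P"
| "afv (ExO P) = afv P"
| "afv (ExA A B P) = afv P"

lemma finite_ofv_obj [simp]: "finite (ofv_obj A)"
  by (cases A) auto

lemma finite_ofv_arr [simp]: "finite (ofv_arr t)"
  by (induction t) auto

lemma finite_ofv [simp]: "finite (ofv P)"
  by (induction P) auto

lemma finite_afv_arr [simp]: "finite (afv_arr t)"
  by (induction t) auto

lemma finite_afv [simp]: "finite (afv P)"
  by (induction P) auto

lemma finite_ovars [simp]: "finite (ovars \<Gamma>)"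
proof -
  have "ovars \<Gamma> \<subseteq> (\<lambda>d. case d of Obj x \<Rightarrow> x | Arr f A B \<Rightarrow> f) ` set \<Gamma>"
    by (force simp: ovars_def)
  then show ?thesis by (rule finite_subset) simp
qed

lemma finite_avars [simp]: "finite (avars \<Gamma>)"
proof -
  have "avars \<Gamma> \<subseteq> (\<lambda>d. case d of Obj x \<Rightarrow> x | Arr f A B \<Rightarrow> f) ` set \<Gamma>"
    by (force simp: avars_def)
  then show ?thesis by (rule finite_subset) simp
qed

lemma ovars_simps [simp]:
  "ovars [] = {}" "ovars (Obj x # \<Gamma>) = insert x (ovars \<Gamma>)" "ovars (Arr f A B # \<Gamma>) = ovars \<Gamma>"
  "ovars (\<Gamma> @ \<Delta>) = ovars \<Gamma> \<union> ovars \<Delta>"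
  by (auto simp: ovars_def)

lemma avars_simps [simp]:
  "avars [] = {}" "avars (Obj x # \<Gamma>) = avars \<Gamma>" "avars (Arr f A B # \<Gamma>) = insert f (avars \<Gamma>)"
  "avars (\<Gamma> @ \<Delta>) = avars \<Gamma> \<union> avars \<Delta>"
  by (auto simp: avars_def)

lemma ovars_mono: "set \<Gamma> \<subseteq> set \<Theta> \<Longrightarrow> ovars \<Gamma> \<subseteq> ovars \<Theta>"
  by (auto simp: ovars_def)

lemma avars_mono: "set \<Gamma> \<subseteq> set \<Theta> \<Longrightarrow> avars \<Gamma> \<subseteq> avars \<Theta>"
  by (auto simp: avars_def)

lemma rename_obj_cong: "(\<And>x. x \<in> ofv_obj A \<Longrightarrow> r x = r' x) \<Longrightarrow> rename_obj r A = rename_obj r' A"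
  by (cases A) auto

lemma rename_arr_cong:
  "(\<And>x. x \<in> ofv_arr t \<Longrightarrow> r x = r' x) \<Longrightarrow> (\<And>f. f \<in> afv_arr t \<Longrightarrow> s f = s' f)
    \<Longrightarrow> rename_arr r s t = rename_arr r' s' t"
  by (induction t) (auto intro: rename_obj_cong)

lemma rename_cong:
  "(\<And>x. x \<in> ofv P \<Longrightarrow> r x = r' x) \<Longrightarrow> (\<And>f. f \<in> afv P \<Longrightarrow> s f = s' f)
    \<Longrightarrow> rename r s P = rename r' s' P"
  by (induction P) (auto intro: rename_obj_cong rename_arr_cong)

lemma rename_obj_oopen:
  "rename_obj r (oopen_obj k U A) = oopen_obj k (rename_obj r U) (rename_obj r A)"
  by (cases A) auto

lemma rename_arr_oopen:
  "rename_arr r s (oopen_arr k U t) = oopen_arr k (rename_obj r U) (rename_arr r s t)"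
  by (induction t) (auto simp: rename_obj_oopen)

lemma rename_oopen: "rename r s (oopen k U P) = oopen k (rename_obj r U) (rename r s P)"
  by (induction P arbitrary: k) (auto simp: rename_obj_oopen rename_arr_oopen)

lemma rename_arr_aopen:
  "rename_arr r s (aopen_arr k u t) = aopen_arr k (rename_arr r s u) (rename_arr r s t)"
  by (induction t) auto

lemma rename_aopen: "rename r s (aopen k u P) = aopen k (rename_arr r s u) (rename r s P)"
  by (induction P arbitrary: k) (auto simp: rename_arr_aopen)

text \<open>Bridge between binders and renamings. An induction hypothesis for a quantifier concerns
  the body opened with a name \<open>x\<close> fresh for the source context; sending
  \<open>x\<close> to \<open>y\<close> turns it into the renamed body opened with \<open>y\<close>.
  Freshness of \<open>x\<close> for \<open>P\<close> keeps the update from touching other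
  occurrences, and no capture can occur because bound variables are indices.\<close>

lemma rename_oopen_fresh:
  assumes "x \<notin> ofv P"
  shows "rename (r(x := y)) s (oopen k (OVar x) P) = oopen k (OVar y) (rename r s P)"
  using assms by (auto simp: rename_oopen intro!: arg_cong[where f = "oopen k (OVar y)"] rename_cong)

lemma rename_aopen_fresh:
  assumes "f \<notin> afv P"
  shows "rename r (s(f := g)) (aopen k (AVar f) P) = aopen k (AVar g) (rename r s P)"
  using assms by (auto simp: rename_aopen intro!: arg_cong[where f = "aopen k (AVar g)"] rename_cong)

section \<open>Absence of dangling bound indices\<close>

lemma oopen_obj_free_of_oopen:
  "oopen_obj j V (oopen_obj i U A) = oopen_obj i U A \<Longrightarrow> i \<noteq> j \<Longrightarrow> oopen_obj j V A = A"
  by (cases A) (auto split: if_splits)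

lemma oopen_arr_free_of_oopen:
  "oopen_arr j V (oopen_arr i U t) = oopen_arr i U t \<Longrightarrow> i \<noteq> j \<Longrightarrow> oopen_arr j V t = t"
  by (induction t) (auto dest: oopen_obj_free_of_oopen)

text \<open>The rules of \<open>fm_in\<close> speak only of opened bodies, so facts on a body under
  its binder have to be recovered from an instance. An occurrence of index \<open>j\<close> in
  \<open>P\<close> survives opening at a different index \<open>i\<close>; hence an opening at
  \<open>j\<close> that leaves the instance unchanged also leaves \<open>P\<close>
  unchanged.\<close>

lemma oopen_free_of_oopen:
  "oopen j V (oopen i U P) = oopen i U P \<Longrightarrow> i \<noteq> j \<Longrightarrow> oopen j V P = P"
  by (induction P arbitrary: i j) (auto dest: oopen_obj_free_of_oopen oopen_arr_free_of_oopen)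

lemma aopen_arr_free_of_aopen:
  "aopen_arr j v (aopen_arr i u t) = aopen_arr i u t \<Longrightarrow> i \<noteq> j \<Longrightarrow> aopen_arr j v t = t"
  by (induction t) (auto split: if_splits)

lemma aopen_free_of_aopen:
  "aopen j v (aopen i u P) = aopen i u P \<Longrightarrow> i \<noteq> j \<Longrightarrow> aopen j v P = P"
  by (induction P arbitrary: i j) (auto dest: aopen_arr_free_of_aopen)

lemma oopen_arr_free_of_aopen:
  "oopen_arr j V (aopen_arr i (AVar f) t) = aopen_arr i (AVar f) t \<Longrightarrow> oopen_arr j V t = t"
  by (induction t) (auto split: if_splits)

lemma oopen_free_of_aopen:
  "oopen j V (aopen i (AVar f) P) = aopen i (AVar f) P \<Longrightarrow> oopen j V P = P"
  by (induction P arbitrary: i j) (auto dest: oopen_arr_free_of_aopen)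

lemma aopen_arr_free_of_oopen:
  "aopen_arr j v (oopen_arr i U t) = oopen_arr i U t \<Longrightarrow> aopen_arr j v t = t"
  by (induction t) (auto split: if_splits)

lemma aopen_free_of_oopen:
  "aopen j v (oopen i U P) = oopen i U P \<Longrightarrow> aopen j v P = P"
  by (induction P arbitrary: i j) (auto dest: aopen_arr_free_of_oopen)

lemma oopen_obj_in [simp]: "obj_in L \<Gamma> A \<Longrightarrow> oopen_obj k U A = A"
  by (auto elim: obj_in.cases)

lemma oopen_arr_in [simp]: "arr_in L \<Gamma> t A B \<Longrightarrow> oopen_arr k U t = t"
  by (induction rule: arr_in.induct) auto

lemma aopen_arr_in [simp]: "arr_in L \<Gamma> t A B \<Longrightarrow> aopen_arr k u t = t"
  by (induction rule: arr_in.induct) auto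

lemma oopen_fm_in: "fm_in L \<Gamma> P \<Longrightarrow> oopen k U P = P"
proof (induction arbitrary: k rule: fm_in.induct)
  case (AllO \<Gamma> P)
  obtain x where "x \<notin> ovars \<Gamma>" using ex_new_if_finite[OF infinite_UNIV_nat finite_ovars] by blast
  from oopen_free_of_oopen[OF AllO.IH[OF this]] show ?case by simp
next
  case (ExO \<Gamma> P)
  obtain x where "x \<notin> ovars \<Gamma>" using ex_new_if_finite[OF infinite_UNIV_nat finite_ovars] by blast
  from oopen_free_of_oopen[OF ExO.IH[OF this]] show ?case by simp
next
  case (AllA \<Gamma> A B P)
  obtain x where "x \<notin> avars \<Gamma>" using ex_new_if_finite[OF infinite_UNIV_nat finite_avars] by blast
  from oopen_free_of_aopen[OF AllA.IH[OF this]] show ?case using AllA.hyps by simp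
next
  case (ExA \<Gamma> A B P)
  obtain x where "x \<notin> avars \<Gamma>" using ex_new_if_finite[OF infinite_UNIV_nat finite_avars] by blast
  from oopen_free_of_aopen[OF ExA.IH[OF this]] show ?case using ExA.hyps by simp
qed auto

lemma aopen_fm_in: "fm_in L \<Gamma> P \<Longrightarrow> aopen k u P = P"
proof (induction arbitrary: k rule: fm_in.induct)
  case (AllO \<Gamma> P)
  obtain x where "x \<notin> ovars \<Gamma>" using ex_new_if_finite[OF infinite_UNIV_nat finite_ovars] by blast
  from aopen_free_of_oopen[OF AllO.IH[OF this]] show ?case by simp
next
  case (ExO \<Gamma> P)
  obtain x where "x \<notin> ovars \<Gamma>" using ex_new_if_finite[OF infinite_UNIV_nat finite_ovars] by blast
  from aopen_free_of_oopen[OF ExO.IH[OF this]] show ?case by simp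
next
  case (AllA \<Gamma> A B P)
  obtain x where "x \<notin> avars \<Gamma>" using ex_new_if_finite[OF infinite_UNIV_nat finite_avars] by blast
  from aopen_free_of_aopen[OF AllA.IH[OF this]] show ?case using AllA.hyps by simp
next
  case (ExA \<Gamma> A B P)
  obtain x where "x \<notin> avars \<Gamma>" using ex_new_if_finite[OF infinite_UNIV_nat finite_avars] by blast
  from aopen_free_of_aopen[OF ExA.IH[OF this]] show ?case using ExA.hyps by simp
qed auto

section \<open>Closing followed by opening\<close>

lemma oopen_obj_oclose:
  "oopen_obj k (OVar z) A = A \<Longrightarrow> oopen_obj k (OVar y) (oclose_obj k x A) = rename_obj (id(x := y)) A"
  by (cases A) (auto split: if_splits)

lemma oopen_arr_oclose:
  "oopen_arr k (OVar z) t = t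
    \<Longrightarrow> oopen_arr k (OVar y) (oclose_arr k x t) = rename_arr (id(x := y)) id t"
  by (induction t) (auto simp: oopen_obj_oclose)

text \<open>Whatever \<open>z\<close> is, the premise expresses that index \<open>k\<close> does not
  dangle in \<open>P\<close>. Otherwise reopening would also hit those old occurrences, and the
  result would not be a mere renaming of \<open>x\<close>.\<close>

lemma oopen_oclose:
  "oopen k (OVar z) P = P \<Longrightarrow> oopen k (OVar y) (oclose k x P) = rename (id(x := y)) id P"
  by (induction P arbitrary: k) (auto simp: oopen_obj_oclose oopen_arr_oclose)

lemma rename_obj_id [simp]: "rename_obj (\<lambda>x. x) A = A" "rename_obj id A = A"
  by (cases A; auto)+

lemma rename_arr_id [simp]: "rename_arr (\<lambda>x. x) (\<lambda>f. f) t = t"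
  by (induction t) auto

lemma rename_id: "rename id id P = P"
  unfolding id_def by (induction P) auto

lemma aopen_arr_aclose:
  "aopen_arr k (AVar z) t = t
    \<Longrightarrow> aopen_arr k (AVar g) (aclose_arr k f t) = rename_arr id (id(f := g)) t"
  by (induction t) (auto split: if_splits)

lemma aopen_aclose:
  "aopen k (AVar z) P = P \<Longrightarrow> aopen k (AVar g) (aclose k f P) = rename id (id(f := g)) P"
  by (induction P arbitrary: k) (auto simp: aopen_arr_aclose)


section \<open>Context morphisms\<close>

lemma obj_in_mono: "obj_in L \<Gamma> A \<Longrightarrow> set \<Gamma> \<subseteq> set \<Theta> \<Longrightarrow> obj_in L \<Theta> A"
  by (induction rule: obj_in.induct) (auto intro: obj_in.intros dest: ovars_mono)

lemma obj_in_append: "obj_in L \<Gamma> A \<Longrightarrow> obj_in L (\<Gamma> @ \<Delta>) A"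
  by (rule obj_in_mono) auto

lemma arr_in_mono: "arr_in L \<Gamma> t A B \<Longrightarrow> set \<Gamma> \<subseteq> set \<Theta> \<Longrightarrow> arr_in L \<Theta> t A B"
  by (induction rule: arr_in.induct) (auto intro: arr_in.intros obj_in_mono)

lemma fm_in_mono: "fm_in L \<Gamma> P \<Longrightarrow> set \<Gamma> \<subseteq> set \<Theta> \<Longrightarrow> fm_in L \<Theta> P"
proof (induction arbitrary: \<Theta> rule: fm_in.induct)
  case (Eq \<Gamma> s A B t)
  then show ?case by (blast intro: fm_in.Eq arr_in_mono)
next
  case (AllO \<Gamma> P)
  show ?case
  proof (rule fm_in.AllO)
    fix x assume "x \<notin> ovars \<Theta>"
    with AllO show "fm_in L (\<Theta> @ [Obj x]) (oopen 0 (OVar x) P)"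
      using ovars_mono[OF AllO.prems] by (intro AllO.IH) auto
  qed
next
  case (ExO \<Gamma> P)
  show ?case
  proof (rule fm_in.ExO)
    fix x assume "x \<notin> ovars \<Theta>"
    with ExO show "fm_in L (\<Theta> @ [Obj x]) (oopen 0 (OVar x) P)"
      using ovars_mono[OF ExO.prems] by (intro ExO.IH) auto
  qed
next
  case (AllA \<Gamma> A B P)
  show ?case
  proof (rule fm_in.AllA)
    fix f assume "f \<notin> avars \<Theta>"
    with AllA show "fm_in L (\<Theta> @ [Arr f A B]) (aopen 0 (AVar f) P)"
      using avars_mono[OF AllA.prems] by (intro AllA.IH) auto
  qed (use AllA obj_in_mono in blast)+
next
  case (ExA \<Gamma> A B P)
  show ?case
  proof (rule fm_in.ExA)
    fix f assume "f \<notin> avars \<Theta>"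
    with ExA show "fm_in L (\<Theta> @ [Arr f A B]) (aopen 0 (AVar f) P)"
      using avars_mono[OF ExA.prems] by (intro ExA.IH) auto
  qed (use ExA obj_in_mono in blast)+
qed (auto intro: fm_in.intros)

lemma arr_in_append: "arr_in L \<Gamma> t A B \<Longrightarrow> arr_in L (\<Gamma> @ \<Delta>) t A B"
  by (rule arr_in_mono) auto

lemma fm_in_append: "fm_in L \<Gamma> P \<Longrightarrow> fm_in L (\<Gamma> @ \<Delta>) P"
  by (rule fm_in_mono) auto

text \<open>An interpretation of \<open>\<Psi>\<close> in \<open>\<Theta>\<close> by variables,
  possibly identifying some of them. It also records that the sorts of declared arrows lie in
  \<open>\<Psi>\<close>, so that changing \<open>r\<close> at a name outside \<open>\<Psi>\<close>
  does not disturb the arrows already interpreted.\<close>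

definition ctx_map ::
  "('c, 'a) lang \<Rightarrow> 'c ctx \<Rightarrow> 'c ctx \<Rightarrow> (nat \<Rightarrow> nat) \<Rightarrow> (nat \<Rightarrow> nat) \<Rightarrow> bool" where
  "ctx_map L \<Psi> \<Theta> r s \<longleftrightarrow>
    (\<forall>x \<in> ovars \<Psi>. r x \<in> ovars \<Theta>) \<and>
    (\<forall>g A B. Arr g A B \<in> set \<Psi> \<longrightarrow> obj_in L \<Psi> A \<and> obj_in L \<Psi> B \<and>
      Arr (s g) (rename_obj r A) (rename_obj r B) \<in> set \<Theta>)"

lemma ctx_map_mono: "ctx_map L \<Psi> \<Theta> r s \<Longrightarrow> set \<Theta> \<subseteq> set \<Theta>' \<Longrightarrow> ctx_map L \<Psi> \<Theta>' r s"
  unfolding ctx_map_def using ovars_mono by blast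

lemma rename_obj_upd:
  "obj_in L \<Psi> A \<Longrightarrow> x \<notin> ovars \<Psi> \<Longrightarrow> rename_obj (r(x := y)) A = rename_obj r A"
  by (auto elim: obj_in.cases)

lemma obj_in_ctx_map: "obj_in L \<Psi> A \<Longrightarrow> ctx_map L \<Psi> \<Theta> r s \<Longrightarrow> obj_in L \<Theta> (rename_obj r A)"
  by (erule obj_in.cases) (auto intro: obj_in.OCon obj_in.OVar simp: ctx_map_def)

lemma arr_in_ctx_map:
  "arr_in L \<Psi> t A B \<Longrightarrow> ctx_map L \<Psi> \<Theta> r s
    \<Longrightarrow> arr_in L \<Theta> (rename_arr r s t) (rename_obj r A) (rename_obj r B)"
proof (induction rule: arr_in.induct)
  case (AVar f A B)
  then show ?case by (auto simp: ctx_map_def intro: arr_in.AVar)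
qed (auto intro: arr_in.intros obj_in_ctx_map)

lemma ctx_map_Obj:
  assumes "ctx_map L \<Psi> \<Theta> r s" "x \<notin> ovars \<Psi>"
  shows "ctx_map L (\<Psi> @ [Obj x]) (\<Theta> @ [Obj y]) (r(x := y)) s"
  unfolding ctx_map_def
proof (intro conjI ballI allI impI)
  fix z assume "z \<in> ovars (\<Psi> @ [Obj x])"
  then show "(r(x := y)) z \<in> ovars (\<Theta> @ [Obj y])"
    using assms by (auto simp: ctx_map_def)
next
  fix g A B assume "Arr g A B \<in> set (\<Psi> @ [Obj x])"
  then have "obj_in L \<Psi> A" "obj_in L \<Psi> B" "Arr (s g) (rename_obj r A) (rename_obj r B) \<in> set \<Theta>"
    using assms by (auto simp: ctx_map_def)
  then show "obj_in L (\<Psi> @ [Obj x]) A" "obj_in L (\<Psi> @ [Obj x]) B"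
    "Arr (s g) (rename_obj (r(x := y)) A) (rename_obj (r(x := y)) B) \<in> set (\<Theta> @ [Obj y])"
    using assms(2) by (auto intro: obj_in_mono simp: rename_obj_upd)
qed

text \<open>The target \<open>\<Theta>'\<close> is left open so that \<open>g\<close> can be newly
  declared, as under a quantifier in \<open>fm_in_ctx_map\<close>, or already present, as in
  \<open>ctx_rel_Arr\<close>.\<close>

lemma ctx_map_Arr:
  assumes "ctx_map L \<Psi> \<Theta> r s" "f \<notin> avars \<Psi>" "obj_in L \<Psi> A" "obj_in L \<Psi> B"
    "set \<Theta> \<subseteq> set \<Theta>'" "Arr g (rename_obj r A) (rename_obj r B) \<in> set \<Theta>'"
  shows "ctx_map L (\<Psi> @ [Arr f A B]) \<Theta>' r (s(f := g))"
  unfolding ctx_map_def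
proof (intro conjI ballI allI impI)
  fix z assume "z \<in> ovars (\<Psi> @ [Arr f A B])"
  then show "r z \<in> ovars \<Theta>'"
    using assms(1) ovars_mono[OF assms(5)] by (auto simp: ctx_map_def)
next
  fix k C D assume *: "Arr k C D \<in> set (\<Psi> @ [Arr f A B])"
  then have "obj_in L \<Psi> C" "obj_in L \<Psi> D"
    using assms by (auto simp: ctx_map_def)
  then show "obj_in L (\<Psi> @ [Arr f A B]) C" "obj_in L (\<Psi> @ [Arr f A B]) D"
    by (auto intro: obj_in_mono)
  from * have "(k = f \<and> C = A \<and> D = B) \<or> (k \<noteq> f \<and> Arr k C D \<in> set \<Psi>)"
    using assms(2) by (auto simp: avars_def)
  then show "Arr ((s(f := g)) k) (rename_obj r C) (rename_obj r D) \<in> set \<Theta>'"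
    using assms by (auto simp: ctx_map_def)
qed

lemma ex_fresh_ovar: "\<exists>x. x \<notin> ovars \<Gamma> \<and> x \<notin> ofv P"
  using ex_new_if_finite[OF infinite_UNIV_nat, of "ovars \<Gamma> \<union> ofv P"] by auto

lemma ex_fresh_avar: "\<exists>f. f \<notin> avars \<Gamma> \<and> f \<notin> afv P"
  using ex_new_if_finite[OF infinite_UNIV_nat, of "avars \<Gamma> \<union> afv P"] by auto

text \<open>At a quantifier one source name is chosen, fresh for both \<open>\<Psi>\<close> and
  \<open>P\<close>, while the target name stays arbitrary. Extending the morphism by this pair of
  names yields every instance that the rule demands.\<close>

lemma fm_in_ctx_map:
  "fm_in L \<Psi> P \<Longrightarrow> ctx_map L \<Psi> \<Theta> r s \<Longrightarrow> fm_in L \<Theta> (rename r s P)"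
proof (induction arbitrary: \<Theta> r s rule: fm_in.induct)
  case (Eq \<Psi> t A B u)
  then show ?case by (auto intro: fm_in.Eq arr_in_ctx_map)
next
  case (AllO \<Psi> P)
  obtain x where x: "x \<notin> ovars \<Psi>" "x \<notin> ofv P" using ex_fresh_ovar by blast
  have "fm_in L (\<Theta> @ [Obj y]) (oopen 0 (OVar y) (rename r s P))" for y
    unfolding rename_oopen_fresh[OF x(2), symmetric]
    by (rule AllO.IH[OF x(1) ctx_map_Obj[OF AllO.prems x(1)]])
  then show ?case by (auto intro: fm_in.AllO)
next
  case (ExO \<Psi> P)
  obtain x where x: "x \<notin> ovars \<Psi>" "x \<notin> ofv P" using ex_fresh_ovar by blast
  have "fm_in L (\<Theta> @ [Obj y]) (oopen 0 (OVar y) (rename r s P))" for y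
    unfolding rename_oopen_fresh[OF x(2), symmetric]
    by (rule ExO.IH[OF x(1) ctx_map_Obj[OF ExO.prems x(1)]])
  then show ?case by (auto intro: fm_in.ExO)
next
  case (AllA \<Psi> A B P)
  obtain f where f: "f \<notin> avars \<Psi>" "f \<notin> afv P" using ex_fresh_avar by blast
  have "fm_in L (\<Theta> @ [Arr g (rename_obj r A) (rename_obj r B)]) (aopen 0 (AVar g) (rename r s P))"
    for g
    unfolding rename_aopen_fresh[OF f(2), symmetric]
    by (rule AllA.IH[OF f(1) ctx_map_Arr[OF AllA.prems f(1) AllA.hyps(1,2)]]) auto
  then show ?case using AllA by (auto intro: fm_in.AllA obj_in_ctx_map)
next
  case (ExA \<Psi> A B P)
  obtain f where f: "f \<notin> avars \<Psi>" "f \<notin> afv P" using ex_fresh_avar by blast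
  have "fm_in L (\<Theta> @ [Arr g (rename_obj r A) (rename_obj r B)]) (aopen 0 (AVar g) (rename r s P))"
    for g
    unfolding rename_aopen_fresh[OF f(2), symmetric]
    by (rule ExA.IH[OF f(1) ctx_map_Arr[OF ExA.prems f(1) ExA.hyps(1,2)]]) auto
  then show ?case using ExA by (auto intro: fm_in.ExA obj_in_ctx_map)
qed (auto intro: fm_in.intros)

lemma is_ctx_obj_in:
  assumes "is_ctx L \<Gamma>" "Arr f A B \<in> set \<Gamma>"
  shows "obj_in L \<Gamma> A" "obj_in L \<Gamma> B"
  using assms by (induction arbitrary: f A B rule: is_ctx.induct)
    (auto intro: obj_in_append)

lemma arr_in_obj_in:
  assumes "arr_in L \<Gamma> t A B" "wf_lang L" "is_ctx L \<Gamma>"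
  shows "obj_in L \<Gamma> A" "obj_in L \<Gamma> B"
  using assms by (induction rule: arr_in.induct)
    (auto intro: is_ctx_obj_in obj_in.OCon simp: wf_lang_def)

lemma ctx_map_id: "is_ctx L \<Gamma> \<Longrightarrow> ctx_map L \<Gamma> \<Gamma> id id"
  by (auto simp: ctx_map_def intro: is_ctx_obj_in)

lemma is_ctx_snoc:
  "is_ctx L (\<Gamma> @ [Obj x]) \<longleftrightarrow> is_ctx L \<Gamma> \<and> x \<notin> ovars \<Gamma>"
  "is_ctx L (\<Gamma> @ [Arr f A B]) \<longleftrightarrow>
    is_ctx L \<Gamma> \<and> obj_in L \<Gamma> A \<and> obj_in L \<Gamma> B \<and> f \<notin> avars \<Gamma>"
  by (auto intro: is_ctx.intros elim: is_ctx.cases)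

lemma is_ctx_append: "is_ctx L (\<Gamma> @ \<Delta>) \<Longrightarrow> is_ctx L \<Gamma>"
proof (induction \<Delta> rule: rev_induct)
  case (snoc d \<Delta>)
  then show ?case by (cases d) (auto simp: is_ctx_snoc simp flip: append_assoc)
qed simp

lemma is_ctx_disjoint:
  "is_ctx L (\<Gamma> @ \<Delta>) \<Longrightarrow> ovars \<Gamma> \<inter> ovars \<Delta> = {} \<and> avars \<Gamma> \<inter> avars \<Delta> = {}"
proof (induction \<Delta> rule: rev_induct)
  case (snoc d \<Delta>)
  then show ?case by (cases d) (auto simp: is_ctx_snoc simp flip: append_assoc)
qed simp


inductive_cases fm_in_ExO: "fm_in L \<Gamma> (ExO P)"
inductive_cases fm_in_AllA: "fm_in L \<Gamma> (AllA A B P)"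
inductive_cases fm_in_ExA: "fm_in L \<Gamma> (ExA A B P)"


section \<open>Stable provability\<close>

text \<open>Provability that persists under extension of context and hypotheses. Building weakening into
  the notion avoids proving that \<open>prov\<close> is closed under renaming of eigenvariables.\<close>

definition sprov ::
  "('c, 'a) lang \<Rightarrow> ('c, 'a) fm set \<Rightarrow> 'c ctx \<Rightarrow> ('c, 'a) fm set \<Rightarrow> ('c, 'a) fm \<Rightarrow> bool" where
  "sprov L T \<Theta> H P \<longleftrightarrow>
    (\<forall>\<Theta>' H'. set \<Theta> \<subseteq> set \<Theta>' \<longrightarrow> H \<subseteq> H' \<longrightarrow> is_ctx L \<Theta>' \<longrightarrow> (\<forall>Q \<in> H'. fm_in L \<Theta>' Q)
      \<longrightarrow> prov L T \<Theta>' H' P)"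

lemma sprovI:
  "(\<And>\<Theta>' H'. set \<Theta> \<subseteq> set \<Theta>' \<Longrightarrow> H \<subseteq> H' \<Longrightarrow> is_ctx L \<Theta>' \<Longrightarrow> \<forall>Q \<in> H'. fm_in L \<Theta>' Q
    \<Longrightarrow> prov L T \<Theta>' H' P) \<Longrightarrow> sprov L T \<Theta> H P"
  by (auto simp: sprov_def)

lemma sprovD:
  "sprov L T \<Theta> H P \<Longrightarrow> set \<Theta> \<subseteq> set \<Theta>' \<Longrightarrow> H \<subseteq> H' \<Longrightarrow> is_ctx L \<Theta>' \<Longrightarrow> \<forall>Q \<in> H'. fm_in L \<Theta>' Q
    \<Longrightarrow> prov L T \<Theta>' H' P"
  by (auto simp: sprov_def)

lemma sprov_mono:
  "sprov L T \<Theta> H P \<Longrightarrow> set \<Theta> \<subseteq> set \<Theta>' \<Longrightarrow> H \<subseteq> H' \<Longrightarrow> sprov L T \<Theta>' H' P"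
  by (rule sprovI, erule sprovD) auto

lemma sprov_Hyp: "P \<in> H \<Longrightarrow> sprov L T \<Theta> H P"
  by (auto intro: sprovI prov.Hyp)

lemma sprov_Axiom: "P \<in> T \<Longrightarrow> sprov L T \<Theta> H P"
  by (auto intro: sprovI prov.Axiom)

lemma sprov_AndI: "sprov L T \<Theta> H P \<Longrightarrow> sprov L T \<Theta> H Q \<Longrightarrow> sprov L T \<Theta> H (And P Q)"
  by (rule sprovI, rule prov.AndI, erule (4) sprovD, erule (4) sprovD)

lemma sprov_AndE1: "sprov L T \<Theta> H (And P Q) \<Longrightarrow> sprov L T \<Theta> H P"
  by (rule sprovI, rule prov.AndE1, erule (4) sprovD)

lemma sprov_AndE2: "sprov L T \<Theta> H (And P Q) \<Longrightarrow> sprov L T \<Theta> H Q"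
  by (rule sprovI, rule prov.AndE2, erule (4) sprovD)

lemma sprov_OrI1: "sprov L T \<Theta> H P \<Longrightarrow> fm_in L \<Theta> Q \<Longrightarrow> sprov L T \<Theta> H (Or P Q)"
  by (rule sprovI, rule prov.OrI1, erule (4) sprovD, erule (1) fm_in_mono)

lemma sprov_OrI2: "sprov L T \<Theta> H Q \<Longrightarrow> fm_in L \<Theta> P \<Longrightarrow> sprov L T \<Theta> H (Or P Q)"
  by (rule sprovI, rule prov.OrI2, erule (4) sprovD, erule (1) fm_in_mono)

text \<open>In contrast to \<open>prov.OrE\<close>, well-sorted disjuncts are demanded: stable
  provability promises nothing under ill-sorted hypotheses, so a new hypothesis has to be known to
  be well-sorted before it is added. The same holds for \<open>sprov_ImpI\<close>.\<close>

lemma sprov_OrE: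
  assumes "sprov L T \<Theta> H (Or P Q)" "fm_in L \<Theta> P" "fm_in L \<Theta> Q"
    "sprov L T \<Theta> (insert P H) R" "sprov L T \<Theta> (insert Q H) R"
  shows "sprov L T \<Theta> H R"
proof (rule sprovI)
  fix \<Theta>' H'
  assume ext: "set \<Theta> \<subseteq> set \<Theta>'" "H \<subseteq> H'" "is_ctx L \<Theta>'" "\<forall>Q \<in> H'. fm_in L \<Theta>' Q"
  show "prov L T \<Theta>' H' R"
  proof (rule prov.OrE)
    show "prov L T \<Theta>' H' (Or P Q)" using assms(1) ext by (rule sprovD)
    show "prov L T \<Theta>' (insert P H') R"
      by (rule sprovD[OF assms(4)]) (use ext fm_in_mono[OF assms(2)] in auto)
    show "prov L T \<Theta>' (insert Q H') R"
      by (rule sprovD[OF assms(5)]) (use ext fm_in_mono[OF assms(3)] in auto)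
  qed
qed

lemma sprov_ImpI:
  assumes "fm_in L \<Theta> P" "sprov L T \<Theta> (insert P H) Q"
  shows "sprov L T \<Theta> H (Imp P Q)"
proof (rule sprovI)
  fix \<Theta>' H'
  assume ext: "set \<Theta> \<subseteq> set \<Theta>'" "H \<subseteq> H'" "is_ctx L \<Theta>'" "\<forall>Q \<in> H'. fm_in L \<Theta>' Q"
  have "prov L T \<Theta>' (insert P H') Q"
    by (rule sprovD[OF assms(2)]) (use ext fm_in_mono[OF assms(1)] in auto)
  then show "prov L T \<Theta>' H' (Imp P Q)" by (rule prov.ImpI)
qed

lemma sprov_ImpE: "sprov L T \<Theta> H (Imp P Q) \<Longrightarrow> sprov L T \<Theta> H P \<Longrightarrow> sprov L T \<Theta> H Q"
  by (rule sprovI, rule prov.ImpE, erule (4) sprovD, erule (4) sprovD)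

text \<open>The eigenvariable can be picked only once the extension \<open>\<Theta>'\<close> is
  known, and it must be fresh for that extension. This is why the premise covers every name fresh
  for \<open>\<Theta>\<close>.\<close>

lemma sprov_AllOI:
  assumes "fm_in L \<Theta> (AllO P)"
    "\<And>x. x \<notin> ovars \<Theta> \<Longrightarrow> sprov L T (\<Theta> @ [Obj x]) H (oopen 0 (OVar x) P)"
  shows "sprov L T \<Theta> H (AllO P)"
proof (rule sprovI)
  fix \<Theta>' H'
  assume ext: "set \<Theta> \<subseteq> set \<Theta>'" "H \<subseteq> H'" "is_ctx L \<Theta>'" "\<forall>Q \<in> H'. fm_in L \<Theta>' Q"
  obtain x where x: "x \<notin> ovars \<Theta>'" using ex_fresh_ovar by blast
  then have "x \<notin> ovars \<Theta>" using ovars_mono[OF ext(1)] by auto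
  then have "prov L T (\<Theta>' @ [Obj x]) H' (oopen 0 (OVar x) P)"
    by (rule sprovD[OF assms(2)]) (use ext x in \<open>auto simp: is_ctx_snoc intro: fm_in_append\<close>)
  then show "prov L T \<Theta>' H' (AllO P)"
    using x ext(4) fm_in_mono[OF assms(1) ext(1)] by (intro prov.AllOI)
qed

lemma sprov_AllOE:
  "sprov L T \<Theta> H (AllO P) \<Longrightarrow> obj_in L \<Theta> U \<Longrightarrow> sprov L T \<Theta> H (oopen 0 U P)"
  by (rule sprovI, rule prov.AllOE, erule (4) sprovD, erule (1) obj_in_mono)

lemma sprov_AllAI:
  assumes "fm_in L \<Theta> (AllA A B P)"
    "\<And>f. f \<notin> avars \<Theta> \<Longrightarrow> sprov L T (\<Theta> @ [Arr f A B]) H (aopen 0 (AVar f) P)"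
  shows "sprov L T \<Theta> H (AllA A B P)"
proof (rule sprovI)
  fix \<Theta>' H'
  assume ext: "set \<Theta> \<subseteq> set \<Theta>'" "H \<subseteq> H'" "is_ctx L \<Theta>'" "\<forall>Q \<in> H'. fm_in L \<Theta>' Q"
  have fm: "fm_in L \<Theta>' (AllA A B P)" using assms(1) ext(1) by (rule fm_in_mono)
  then have AB: "obj_in L \<Theta>' A" "obj_in L \<Theta>' B" by (blast elim: fm_in_AllA)+
  obtain f where f: "f \<notin> avars \<Theta>'" using ex_fresh_avar by blast
  then have "f \<notin> avars \<Theta>" using avars_mono[OF ext(1)] by auto
  then have "prov L T (\<Theta>' @ [Arr f A B]) H' (aopen 0 (AVar f) P)"
    by (rule sprovD[OF assms(2)]) (use ext f AB in \<open>auto simp: is_ctx_snoc intro: fm_in_append\<close>)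
  then show "prov L T \<Theta>' H' (AllA A B P)"
    using f ext(4) fm by (intro prov.AllAI)
qed

lemma sprov_AllAE:
  "sprov L T \<Theta> H (AllA A B P) \<Longrightarrow> arr_in L \<Theta> u A B \<Longrightarrow> sprov L T \<Theta> H (aopen 0 u P)"
  by (rule sprovI, rule prov.AllAE, erule (4) sprovD, erule (1) arr_in_mono)

lemma sprov_ExOI:
  "fm_in L \<Theta> (ExO P) \<Longrightarrow> obj_in L \<Theta> U \<Longrightarrow> sprov L T \<Theta> H (oopen 0 U P) \<Longrightarrow> sprov L T \<Theta> H (ExO P)"
  by (rule sprovI, rule prov.ExOI, erule (1) fm_in_mono, erule (1) obj_in_mono, erule (4) sprovD)

lemma sprov_ExOE:
  assumes "sprov L T \<Theta> H (ExO P)" "fm_in L \<Theta> (ExO P)" "fm_in L \<Theta> R"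
    "\<And>x. x \<notin> ovars \<Theta> \<Longrightarrow> sprov L T (\<Theta> @ [Obj x]) (insert (oopen 0 (OVar x) P) H) R"
  shows "sprov L T \<Theta> H R"
proof (rule sprovI)
  fix \<Theta>' H'
  assume ext: "set \<Theta> \<subseteq> set \<Theta>'" "H \<subseteq> H'" "is_ctx L \<Theta>'" "\<forall>Q \<in> H'. fm_in L \<Theta>' Q"
  have fm: "fm_in L \<Theta>' (ExO P)" using assms(2) ext(1) by (rule fm_in_mono)
  obtain x where x: "x \<notin> ovars \<Theta>'" using ex_fresh_ovar by blast
  then have "x \<notin> ovars \<Theta>" using ovars_mono[OF ext(1)] by auto
  moreover have "fm_in L (\<Theta>' @ [Obj x]) (oopen 0 (OVar x) P)"
    using fm x by (blast elim: fm_in_ExO)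
  ultimately have "prov L T (\<Theta>' @ [Obj x]) (insert (oopen 0 (OVar x) P) H') R"
    by (intro sprovD[OF assms(4)]) (use ext x in \<open>auto simp: is_ctx_snoc intro: fm_in_append\<close>)
  with sprovD[OF assms(1) ext] x fm_in_mono[OF assms(3) ext(1)] show "prov L T \<Theta>' H' R"
    by (rule prov.ExOE)
qed

lemma sprov_ExAI:
  "fm_in L \<Theta> (ExA A B P) \<Longrightarrow> arr_in L \<Theta> u A B \<Longrightarrow> sprov L T \<Theta> H (aopen 0 u P)
    \<Longrightarrow> sprov L T \<Theta> H (ExA A B P)"
  by (rule sprovI, rule prov.ExAI, erule (1) fm_in_mono, erule (1) arr_in_mono, erule (4) sprovD)

lemma sprov_ExAE:
  assumes "sprov L T \<Theta> H (ExA A B P)" "fm_in L \<Theta> (ExA A B P)" "fm_in L \<Theta> R"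
    "\<And>f. f \<notin> avars \<Theta> \<Longrightarrow> sprov L T (\<Theta> @ [Arr f A B]) (insert (aopen 0 (AVar f) P) H) R"
  shows "sprov L T \<Theta> H R"
proof (rule sprovI)
  fix \<Theta>' H'
  assume ext: "set \<Theta> \<subseteq> set \<Theta>'" "H \<subseteq> H'" "is_ctx L \<Theta>'" "\<forall>Q \<in> H'. fm_in L \<Theta>' Q"
  have fm: "fm_in L \<Theta>' (ExA A B P)" using assms(2) ext(1) by (rule fm_in_mono)
  then have AB: "obj_in L \<Theta>' A" "obj_in L \<Theta>' B" by (blast elim: fm_in_ExA)+
  obtain f where f: "f \<notin> avars \<Theta>'" using ex_fresh_avar by blast
  then have "f \<notin> avars \<Theta>" using avars_mono[OF ext(1)] by auto
  moreover have "fm_in L (\<Theta>' @ [Arr f A B]) (aopen 0 (AVar f) P)"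
    using fm f by (blast elim: fm_in_ExA)
  ultimately have "prov L T (\<Theta>' @ [Arr f A B]) (insert (aopen 0 (AVar f) P) H') R"
    by (intro sprovD[OF assms(4)]) (use ext f AB in \<open>auto simp: is_ctx_snoc intro: fm_in_append\<close>)
  with sprovD[OF assms(1) ext] f fm_in_mono[OF assms(3) ext(1)] show "prov L T \<Theta>' H' R"
    by (rule prov.ExAE)
qed

lemma sprov_Conj: "sprov L T \<Theta> H (Conj Ps) \<Longrightarrow> P \<in> set Ps \<Longrightarrow> sprov L T \<Theta> H P"
proof (induction Ps)
  case (Cons Q Ps)
  from Cons.prems(1) have "sprov L T \<Theta> H (And Q (Conj Ps))" by (simp add: Conj_def)
  from sprov_AndE1[OF this] sprov_AndE2[OF this] Cons show ?case by auto
qed simp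

lemma fm_in_Conj: "(\<And>P. P \<in> set Ps \<Longrightarrow> fm_in L \<Theta> P) \<Longrightarrow> fm_in L \<Theta> (Conj Ps)"
  by (induction Ps) (auto simp: Conj_def Top_def intro: fm_in.And fm_in.Imp fm_in.Bot)

section \<open>Universal closure over a context\<close>

lemma fm_in_all_decl:
  assumes "is_ctx L (\<Gamma> @ [d])" "fm_in L (\<Gamma> @ [d]) P"
  shows "fm_in L \<Gamma> (all_decl d P)"
proof (cases d)
  case (Obj x)
  with assms have \<Gamma>: "is_ctx L \<Gamma>" "x \<notin> ovars \<Gamma>" by (auto simp: is_ctx_snoc)
  \<comment> \<open>Closing \<open>x\<close> and reopening with \<open>y\<close> amounts to renaming
    \<open>x\<close> to \<open>y\<close>, a context morphism that fixes \<open>\<Gamma>\<close>; so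
    every instance of the body is well-sorted.\<close>
  have "fm_in L (\<Gamma> @ [Obj y]) (oopen 0 (OVar y) (oclose 0 x P))" for y
    unfolding oopen_oclose[OF oopen_fm_in[OF assms(2)]]
    using assms(2) ctx_map_Obj[OF ctx_map_id[OF \<Gamma>(1)] \<Gamma>(2)] unfolding Obj by (rule fm_in_ctx_map)
  then show ?thesis unfolding Obj all_decl.simps by (rule fm_in.AllO)
next
  case (Arr f A B)
  with assms have \<Gamma>: "is_ctx L \<Gamma>" "f \<notin> avars \<Gamma>" "obj_in L \<Gamma> A" "obj_in L \<Gamma> B"
    by (auto simp: is_ctx_snoc)
  have "ctx_map L (\<Gamma> @ [Arr f A B]) (\<Gamma> @ [Arr g A B]) id (id(f := g))" for g
    by (rule ctx_map_Arr[OF ctx_map_id[OF \<Gamma>(1)] \<Gamma>(2-4)]) (auto simp: id_def)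
  then have "fm_in L (\<Gamma> @ [Arr g A B]) (aopen 0 (AVar g) (aclose 0 f P))" for g
    unfolding aopen_aclose[OF aopen_fm_in[OF assms(2)]]
    by (rule fm_in_ctx_map[OF assms(2)[unfolded Arr]])
  with \<Gamma>(3,4) show ?thesis unfolding Arr all_decl.simps by (rule fm_in.AllA)
qed

lemma prov_all_decl:
  assumes "is_ctx L (\<Gamma> @ [d])" "fm_in L (\<Gamma> @ [d]) P" "prov L T (\<Gamma> @ [d]) {} P"
  shows "prov L T \<Gamma> {} (all_decl d P)"
proof (cases d)
  case (Obj x)
  \<comment> \<open>With the declared name itself as eigenvariable, reopening undoes
    closing.\<close>
  have "id(x := x) = id" by auto
  then have P: "oopen 0 (OVar x) (oclose 0 x P) = P"
    unfolding oopen_oclose[OF oopen_fm_in[OF assms(2)]] by (simp only: rename_id)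
  show ?thesis unfolding Obj all_decl.simps
  proof (rule prov.AllOI[of x])
    show "x \<notin> ovars \<Gamma>" using assms(1) by (simp add: Obj is_ctx_snoc)
    show "fm_in L \<Gamma> (AllO (oclose 0 x P))" using fm_in_all_decl[OF assms(1,2)] by (simp add: Obj)
    show "prov L T (\<Gamma> @ [Obj x]) {} (oopen 0 (OVar x) (oclose 0 x P))"
      unfolding P using assms(3) by (simp only: Obj)
  qed simp
next
  case (Arr f A B)
  have "id(f := f) = id" by auto
  then have P: "aopen 0 (AVar f) (aclose 0 f P) = P"
    unfolding aopen_aclose[OF aopen_fm_in[OF assms(2)]] by (simp only: rename_id)
  show ?thesis unfolding Arr all_decl.simps
  proof (rule prov.AllAI[of f])
    show "f \<notin> avars \<Gamma>" using assms(1) by (simp add: Arr is_ctx_snoc)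
    show "fm_in L \<Gamma> (AllA A B (aclose 0 f P))" using fm_in_all_decl[OF assms(1,2)] by (simp add: Arr)
    show "prov L T (\<Gamma> @ [Arr f A B]) {} (aopen 0 (AVar f) (aclose 0 f P))"
      unfolding P using assms(3) by (simp only: Arr)
  qed simp
qed

text \<open>\<open>\<Gamma>\<close> varies in the induction because it absorbs the declarations of
  \<open>\<Delta>\<close> from the left. Well-sortedness is proved along with provability, since
  each generalisation needs it for its body.\<close>

lemma prov_all_ctx:
  assumes "is_ctx L (\<Gamma> @ \<Delta>)" "fm_in L (\<Gamma> @ \<Delta>) P" "prov L T (\<Gamma> @ \<Delta>) {} P"
  shows "fm_in L \<Gamma> (all_ctx \<Delta> P) \<and> prov L T \<Gamma> {} (all_ctx \<Delta> P)"
  using assms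
proof (induction \<Delta> arbitrary: \<Gamma>)
  case (Cons d \<Delta>)
  have body: "fm_in L (\<Gamma> @ [d]) (all_ctx \<Delta> P) \<and> prov L T (\<Gamma> @ [d]) {} (all_ctx \<Delta> P)"
    using Cons.prems by (intro Cons.IH) simp_all
  have "is_ctx L (\<Gamma> @ [d])"
    using Cons.prems(1) is_ctx_append[of L "\<Gamma> @ [d]" \<Delta>] by simp
  with body have "fm_in L \<Gamma> (all_decl d (all_ctx \<Delta> P))" "prov L T \<Gamma> {} (all_decl d (all_ctx \<Delta> P))"
    using fm_in_all_decl prov_all_decl by blast+
  then show ?case by (simp add: all_ctx_def)
qed (simp add: all_ctx_def)


section \<open>Equational reasoning\<close>

locale category_theory =
  fixes L :: "('c, 'a) lang" and T :: "('c, 'a) fm set"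
  assumes wf: "wf_lang L" and is_th: "is_theory L T"
begin

text \<open>An equation is kept together with its sort and its context, because the axioms can be
  instantiated only at well-sorted terms. This lets equations be chained and composed without
  separate typing arguments.\<close>

definition eqn ::
  "'c ctx \<Rightarrow> ('c, 'a) fm set \<Rightarrow> 'c obj \<Rightarrow> 'c obj \<Rightarrow> ('c, 'a) arr \<Rightarrow> ('c, 'a) arr \<Rightarrow> bool" where
  "eqn \<Theta> H A B s t \<longleftrightarrow> is_ctx L \<Theta> \<and> arr_in L \<Theta> s A B \<and> arr_in L \<Theta> t A B \<and> sprov L T \<Theta> H (Eq s t)"

lemma eqn_mono:
  "eqn \<Theta> H A B s t \<Longrightarrow> is_ctx L \<Theta>' \<Longrightarrow> set \<Theta> \<subseteq> set \<Theta>' \<Longrightarrow> H \<subseteq> H' \<Longrightarrow> eqn \<Theta>' H' A B s t"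
  by (auto simp: eqn_def intro: arr_in_mono sprov_mono)

lemma eqn_refl:
  assumes "is_ctx L \<Theta>" "arr_in L \<Theta> t A B"
  shows "eqn \<Theta> H A B t t"
proof -
  have AB: "obj_in L \<Theta> A" "obj_in L \<Theta> B" using arr_in_obj_in[OF assms(2) wf assms(1)] by auto
  \<comment> \<open>The reflexivity axiom with its closure evaluated. The outermost variable has the
    largest index: \<open>OBnd 1\<close> is the source and \<open>OBnd 0\<close> the target. The
    later axioms are instantiated in the same manner.\<close>
  have "sprov L T \<Theta> H (AllO (AllO (AllA (OBnd 1) (OBnd 0) (Eq (ABnd 0) (ABnd 0)))))"
    by (rule sprov_Axiom) (use is_th in \<open>simp add: is_theory_def eq_axioms_def all_ctx_def\<close>)
  from sprov_AllOE[OF this AB(1)]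
  have "sprov L T \<Theta> H (AllO (AllA A (OBnd 0) (Eq (ABnd 0) (ABnd 0))))" by simp
  from sprov_AllOE[OF this AB(2)]
  have "sprov L T \<Theta> H (AllA A B (Eq (ABnd 0) (ABnd 0)))" using AB by simp
  from sprov_AllAE[OF this assms(2)] show ?thesis using assms by (simp add: eqn_def)
qed

lemma eqn_sym:
  assumes "eqn \<Theta> H A B s t"
  shows "eqn \<Theta> H A B t s"
proof -
  have st: "is_ctx L \<Theta>" "arr_in L \<Theta> s A B" "arr_in L \<Theta> t A B" "sprov L T \<Theta> H (Eq s t)"
    using assms by (auto simp: eqn_def)
  have AB: "obj_in L \<Theta> A" "obj_in L \<Theta> B" using arr_in_obj_in[OF st(2) wf st(1)] by auto
  have "sprov L T \<Theta> H (AllO (AllO (AllA (OBnd 1) (OBnd 0) (AllA (OBnd 1) (OBnd 0)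
      (Imp (Eq (ABnd 1) (ABnd 0)) (Eq (ABnd 0) (ABnd 1)))))))"
    by (rule sprov_Axiom) (use is_th in \<open>simp add: is_theory_def eq_axioms_def all_ctx_def\<close>)
  from sprov_AllOE[OF this AB(1)]
  have "sprov L T \<Theta> H (AllO (AllA A (OBnd 0) (AllA A (OBnd 0)
      (Imp (Eq (ABnd 1) (ABnd 0)) (Eq (ABnd 0) (ABnd 1))))))" by simp
  from sprov_AllOE[OF this AB(2)]
  have "sprov L T \<Theta> H (AllA A B (AllA A B
      (Imp (Eq (ABnd 1) (ABnd 0)) (Eq (ABnd 0) (ABnd 1)))))" using AB by simp
  from sprov_AllAE[OF this st(2)]
  have "sprov L T \<Theta> H (AllA A B (Imp (Eq s (ABnd 0)) (Eq (ABnd 0) s)))" by simp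
  from sprov_AllAE[OF this st(3)]
  have "sprov L T \<Theta> H (Imp (Eq s t) (Eq t s))" using st by simp
  then show ?thesis using st by (auto simp: eqn_def intro: sprov_ImpE)
qed

lemma eqn_trans [trans]:
  assumes "eqn \<Theta> H A B s t" "eqn \<Theta> H A B t u"
  shows "eqn \<Theta> H A B s u"
proof -
  have st: "is_ctx L \<Theta>" "arr_in L \<Theta> s A B" "arr_in L \<Theta> t A B" "arr_in L \<Theta> u A B"
    "sprov L T \<Theta> H (And (Eq s t) (Eq t u))"
    using assms by (auto simp: eqn_def intro: sprov_AndI)
  have AB: "obj_in L \<Theta> A" "obj_in L \<Theta> B" using arr_in_obj_in[OF st(2) wf st(1)] by auto
  let ?P = "Imp (And (Eq (ABnd 2) (ABnd 1)) (Eq (ABnd 1) (ABnd 0))) (Eq (ABnd 2) (ABnd 0))"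
  have "sprov L T \<Theta> H (AllO (AllO (AllA (OBnd 1) (OBnd 0) (AllA (OBnd 1) (OBnd 0)
      (AllA (OBnd 1) (OBnd 0) ?P)))))"
    by (rule sprov_Axiom)
      (use is_th in \<open>simp add: is_theory_def eq_axioms_def all_ctx_def numeral_2_eq_2\<close>)
  from sprov_AllOE[OF this AB(1)]
  have "sprov L T \<Theta> H (AllO (AllA A (OBnd 0) (AllA A (OBnd 0) (AllA A (OBnd 0) ?P))))" by simp
  from sprov_AllOE[OF this AB(2)]
  have "sprov L T \<Theta> H (AllA A B (AllA A B (AllA A B ?P)))" using AB by simp
  from sprov_AllAE[OF this st(2)]
  have "sprov L T \<Theta> H (AllA A B (AllA A B
      (Imp (And (Eq s (ABnd 1)) (Eq (ABnd 1) (ABnd 0))) (Eq s (ABnd 0)))))"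
    by (simp add: numeral_2_eq_2)
  from sprov_AllAE[OF this st(3)]
  have "sprov L T \<Theta> H (AllA A B (Imp (And (Eq s t) (Eq t (ABnd 0))) (Eq s (ABnd 0))))"
    using st by simp
  from sprov_AllAE[OF this st(4)]
  have "sprov L T \<Theta> H (Imp (And (Eq s t) (Eq t u)) (Eq s u))" using st by simp
  then show ?thesis using st by (auto simp: eqn_def intro: sprov_ImpE)
qed

lemma eqn_Comp:
  assumes "eqn \<Theta> H A B s t" "eqn \<Theta> H B C u v"
  shows "eqn \<Theta> H A C (Comp u s) (Comp v t)"
proof -
  have st: "is_ctx L \<Theta>" "arr_in L \<Theta> s A B" "arr_in L \<Theta> t A B" "arr_in L \<Theta> u B C" "arr_in L \<Theta> v B C"
    "sprov L T \<Theta> H (And (Eq s t) (Eq u v))"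
    using assms by (auto simp: eqn_def intro: sprov_AndI)
  have AB: "obj_in L \<Theta> A" "obj_in L \<Theta> B" "obj_in L \<Theta> C"
    using arr_in_obj_in[OF st(2) wf st(1)] arr_in_obj_in[OF st(4) wf st(1)] by auto
  let ?P = "Imp (And (Eq (ABnd 3) (ABnd 2)) (Eq (ABnd 1) (ABnd 0)))
      (Eq (Comp (ABnd 1) (ABnd 3)) (Comp (ABnd 0) (ABnd 2)))"
  have "sprov L T \<Theta> H (AllO (AllO (AllO (AllA (OBnd 2) (OBnd 1) (AllA (OBnd 2) (OBnd 1)
      (AllA (OBnd 1) (OBnd 0) (AllA (OBnd 1) (OBnd 0) ?P)))))))"
    by (rule sprov_Axiom) (use is_th in
      \<open>simp add: is_theory_def eq_axioms_def all_ctx_def numeral_2_eq_2 numeral_3_eq_3\<close>)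
  from sprov_AllOE[OF this AB(1)]
  have "sprov L T \<Theta> H (AllO (AllO (AllA A (OBnd 1) (AllA A (OBnd 1)
      (AllA (OBnd 1) (OBnd 0) (AllA (OBnd 1) (OBnd 0) ?P))))))" by (simp add: numeral_2_eq_2)
  from sprov_AllOE[OF this AB(2)]
  have "sprov L T \<Theta> H (AllO (AllA A B (AllA A B
      (AllA B (OBnd 0) (AllA B (OBnd 0) ?P)))))" using AB by simp
  from sprov_AllOE[OF this AB(3)]
  have "sprov L T \<Theta> H (AllA A B (AllA A B (AllA B C (AllA B C ?P))))" using AB by simp
  from sprov_AllAE[OF this st(2)]
  have "sprov L T \<Theta> H (AllA A B (AllA B C (AllA B C
      (Imp (And (Eq s (ABnd 2)) (Eq (ABnd 1) (ABnd 0)))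
        (Eq (Comp (ABnd 1) s) (Comp (ABnd 0) (ABnd 2)))))))"
    by (simp add: numeral_2_eq_2 numeral_3_eq_3)
  from sprov_AllAE[OF this st(3)]
  have "sprov L T \<Theta> H (AllA B C (AllA B C
      (Imp (And (Eq s t) (Eq (ABnd 1) (ABnd 0)))
        (Eq (Comp (ABnd 1) s) (Comp (ABnd 0) t)))))"
    using st by (simp add: numeral_2_eq_2)
  from sprov_AllAE[OF this st(4)]
  have "sprov L T \<Theta> H (AllA B C
      (Imp (And (Eq s t) (Eq u (ABnd 0))) (Eq (Comp u s) (Comp (ABnd 0) t))))"
    using st by simp
  from sprov_AllAE[OF this st(5)]
  have "sprov L T \<Theta> H (Imp (And (Eq s t) (Eq u v)) (Eq (Comp u s) (Comp v t)))"
    using st by simp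
  then show ?thesis using st by (auto simp: eqn_def intro: sprov_ImpE arr_in.Comp)
qed

lemma eqn_Ident_right:
  assumes "is_ctx L \<Theta>" "arr_in L \<Theta> t A B"
  shows "eqn \<Theta> H A B (Comp t (Ident A)) t"
proof -
  have AB: "obj_in L \<Theta> A" "obj_in L \<Theta> B" using arr_in_obj_in[OF assms(2) wf assms(1)] by auto
  have "sprov L T \<Theta> H (AllO (AllO (AllA (OBnd 1) (OBnd 0)
      (Eq (Comp (ABnd 0) (Ident (OBnd 1))) (ABnd 0)))))"
    by (rule sprov_Axiom) (use is_th in \<open>simp add: is_theory_def cat_axioms_def all_ctx_def\<close>)
  from sprov_AllOE[OF this AB(1)]
  have "sprov L T \<Theta> H (AllO (AllA A (OBnd 0) (Eq (Comp (ABnd 0) (Ident A)) (ABnd 0))))" by simp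
  from sprov_AllOE[OF this AB(2)]
  have "sprov L T \<Theta> H (AllA A B (Eq (Comp (ABnd 0) (Ident A)) (ABnd 0)))" using AB by simp
  from sprov_AllAE[OF this assms(2)] show ?thesis
    using assms AB by (auto simp: eqn_def intro: arr_in.intros)
qed

lemma eqn_Ident_left:
  assumes "is_ctx L \<Theta>" "arr_in L \<Theta> t A B"
  shows "eqn \<Theta> H A B (Comp (Ident B) t) t"
proof -
  have AB: "obj_in L \<Theta> A" "obj_in L \<Theta> B" using arr_in_obj_in[OF assms(2) wf assms(1)] by auto
  have "sprov L T \<Theta> H (AllO (AllO (AllA (OBnd 1) (OBnd 0)
      (Eq (Comp (Ident (OBnd 0)) (ABnd 0)) (ABnd 0)))))"
    by (rule sprov_Axiom) (use is_th in \<open>simp add: is_theory_def cat_axioms_def all_ctx_def\<close>)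
  from sprov_AllOE[OF this AB(1)]
  have "sprov L T \<Theta> H (AllO (AllA A (OBnd 0) (Eq (Comp (Ident (OBnd 0)) (ABnd 0)) (ABnd 0))))"
    by simp
  from sprov_AllOE[OF this AB(2)]
  have "sprov L T \<Theta> H (AllA A B (Eq (Comp (Ident B) (ABnd 0)) (ABnd 0)))" using AB by simp
  from sprov_AllAE[OF this assms(2)] show ?thesis
    using assms AB by (auto simp: eqn_def intro: arr_in.intros)
qed

lemma eqn_Ident_swap:
  "is_ctx L \<Theta> \<Longrightarrow> arr_in L \<Theta> t A B \<Longrightarrow> eqn \<Theta> H A B (Comp t (Ident A)) (Comp (Ident B) t)"
  by (rule eqn_trans[OF eqn_Ident_right eqn_sym[OF eqn_Ident_left]])

lemma eqn_assoc:
  assumes "is_ctx L \<Theta>" "arr_in L \<Theta> s A B" "arr_in L \<Theta> t B C" "arr_in L \<Theta> u C D"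
  shows "eqn \<Theta> H A D (Comp u (Comp t s)) (Comp (Comp u t) s)"
proof -
  have AB: "obj_in L \<Theta> A" "obj_in L \<Theta> B" "obj_in L \<Theta> C" "obj_in L \<Theta> D"
    using arr_in_obj_in[OF assms(2) wf assms(1)] arr_in_obj_in[OF assms(4) wf assms(1)] by auto
  let ?P = "Eq (Comp (ABnd 0) (Comp (ABnd 1) (ABnd 2))) (Comp (Comp (ABnd 0) (ABnd 1)) (ABnd 2))"
  have "sprov L T \<Theta> H (AllO (AllO (AllO (AllO (AllA (OBnd 3) (OBnd 2) (AllA (OBnd 2) (OBnd 1)
      (AllA (OBnd 1) (OBnd 0) ?P)))))))"
    by (rule sprov_Axiom) (use is_th in
      \<open>simp add: is_theory_def cat_axioms_def all_ctx_def numeral_2_eq_2 numeral_3_eq_3\<close>)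
  from sprov_AllOE[OF this AB(1)]
  have "sprov L T \<Theta> H (AllO (AllO (AllO (AllA A (OBnd 2) (AllA (OBnd 2) (OBnd 1)
      (AllA (OBnd 1) (OBnd 0) ?P))))))" by (simp add: numeral_2_eq_2 numeral_3_eq_3)
  from sprov_AllOE[OF this AB(2)]
  have "sprov L T \<Theta> H (AllO (AllO (AllA A B (AllA B (OBnd 1)
      (AllA (OBnd 1) (OBnd 0) ?P)))))" using AB by (simp add: numeral_2_eq_2)
  from sprov_AllOE[OF this AB(3)]
  have "sprov L T \<Theta> H (AllO (AllA A B (AllA B C (AllA C (OBnd 0) ?P))))" using AB by simp
  from sprov_AllOE[OF this AB(4)]
  have "sprov L T \<Theta> H (AllA A B (AllA B C (AllA C D ?P)))" using AB by simp
  from sprov_AllAE[OF this assms(2)]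
  have "sprov L T \<Theta> H (AllA B C (AllA C D
      (Eq (Comp (ABnd 0) (Comp (ABnd 1) s)) (Comp (Comp (ABnd 0) (ABnd 1)) s))))"
    by (simp add: numeral_2_eq_2)
  from sprov_AllAE[OF this assms(3)]
  have "sprov L T \<Theta> H (AllA C D (Eq (Comp (ABnd 0) (Comp t s)) (Comp (Comp (ABnd 0) t) s)))"
    using assms by simp
  from sprov_AllAE[OF this assms(4)] show ?thesis
    using assms by (auto simp: eqn_def intro: arr_in.Comp)
qed


section \<open>Inverse pairs and the elimination of invertibility\<close>

definition inverse_pair ::
  "'c ctx \<Rightarrow> ('c, 'a) fm set \<Rightarrow> 'c obj \<Rightarrow> 'c obj \<Rightarrow> ('c, 'a) arr \<Rightarrow> ('c, 'a) arr \<Rightarrow> bool" where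
  "inverse_pair \<Theta> H A B u v \<longleftrightarrow> arr_in L \<Theta> u A B \<and> arr_in L \<Theta> v B A \<and>
    eqn \<Theta> H A A (Comp v u) (Ident A) \<and> eqn \<Theta> H B B (Comp u v) (Ident B)"

lemma inverse_pair_sym: "inverse_pair \<Theta> H A B u v \<Longrightarrow> inverse_pair \<Theta> H B A v u"
  by (auto simp: inverse_pair_def)

lemma inverse_pair_mono:
  "inverse_pair \<Theta> H A B u v \<Longrightarrow> is_ctx L \<Theta>' \<Longrightarrow> set \<Theta> \<subseteq> set \<Theta>' \<Longrightarrow> H \<subseteq> H'
    \<Longrightarrow> inverse_pair \<Theta>' H' A B u v"
  by (auto simp: inverse_pair_def intro: arr_in_mono eqn_mono)

lemma inverse_pair_Ident:
  assumes "is_ctx L \<Theta>" "obj_in L \<Theta> A"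
  shows "inverse_pair \<Theta> H A A (Ident A) (Ident A)"
  using assms arr_in.Ident[OF assms(2)] eqn_Ident_left by (auto simp: inverse_pair_def)

lemma eqn_cancel_right:
  assumes "inverse_pair \<Theta> H A B u v" "arr_in L \<Theta> t B C"
  shows "eqn \<Theta> H B C (Comp (Comp t u) v) t"
proof -
  have uv: "is_ctx L \<Theta>" "arr_in L \<Theta> u A B" "arr_in L \<Theta> v B A" "eqn \<Theta> H B B (Comp u v) (Ident B)"
    using assms(1) by (auto simp: inverse_pair_def eqn_def)
  have "eqn \<Theta> H B C (Comp (Comp t u) v) (Comp t (Comp u v))"
    using uv assms by (blast intro: eqn_sym eqn_assoc)
  also have "eqn \<Theta> H B C (Comp t (Comp u v)) (Comp t (Ident B))"
    using uv assms by (blast intro: eqn_Comp eqn_refl)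
  also have "eqn \<Theta> H B C (Comp t (Ident B)) t"
    using uv assms by (blast intro: eqn_Ident_right)
  finally show ?thesis .
qed

lemma eqn_cancel_left:
  assumes "inverse_pair \<Theta> H A B u v" "arr_in L \<Theta> t C A"
  shows "eqn \<Theta> H C A (Comp v (Comp u t)) t"
proof -
  have uv: "is_ctx L \<Theta>" "arr_in L \<Theta> u A B" "arr_in L \<Theta> v B A" "eqn \<Theta> H A A (Comp v u) (Ident A)"
    using assms(1) by (auto simp: inverse_pair_def eqn_def)
  have "eqn \<Theta> H C A (Comp v (Comp u t)) (Comp (Comp v u) t)"
    using uv assms by (blast intro: eqn_assoc)
  also have "eqn \<Theta> H C A (Comp (Comp v u) t) (Comp (Ident A) t)"
    using uv assms by (blast intro: eqn_Comp eqn_refl)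
  also have "eqn \<Theta> H C A (Comp (Ident A) t) t"
    using uv assms by (blast intro: eqn_Ident_left)
  finally show ?thesis .
qed

text \<open>Composing the square with \<open>b'\<close> on the left and \<open>a'\<close> on the
  right cancels \<open>b\<close> and \<open>a\<close>. This is what makes \<open>ctx_rel\<close>
  symmetric.\<close>

lemma eqn_inverse_square:
  assumes "inverse_pair \<Theta> H A1 A2 a a'" "inverse_pair \<Theta> H B1 B2 b b'"
    "arr_in L \<Theta> t1 A1 B1" "arr_in L \<Theta> t2 A2 B2"
    "eqn \<Theta> H A1 B2 (Comp t2 a) (Comp b t1)"
  shows "eqn \<Theta> H A2 B1 (Comp t1 a') (Comp b' t2)"
proof -
  have ab: "is_ctx L \<Theta>" "arr_in L \<Theta> a A1 A2" "arr_in L \<Theta> a' A2 A1" "arr_in L \<Theta> b B1 B2"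
    "arr_in L \<Theta> b' B2 B1"
    using assms(1,2) by (auto simp: inverse_pair_def eqn_def)
  have "eqn \<Theta> H A2 B1 (Comp t1 a') (Comp b' (Comp b (Comp t1 a')))"
    using ab assms by (blast intro: eqn_sym eqn_cancel_left arr_in.Comp)
  also have "eqn \<Theta> H A2 B1 (Comp b' (Comp b (Comp t1 a'))) (Comp b' (Comp (Comp b t1) a'))"
    using ab assms by (blast intro: eqn_Comp eqn_refl eqn_assoc)
  also have "eqn \<Theta> H A2 B1 (Comp b' (Comp (Comp b t1) a')) (Comp b' (Comp (Comp t2 a) a'))"
    using ab assms by (blast intro: eqn_Comp eqn_refl eqn_sym)
  also have "eqn \<Theta> H A2 B1 (Comp b' (Comp (Comp t2 a) a')) (Comp b' t2)"
    using ab assms by (blast intro: eqn_Comp eqn_refl eqn_cancel_right)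
  finally show ?thesis .
qed

lemma fm_in_is_iso:
  assumes "is_ctx L \<Theta>" "arr_in L \<Theta> u A B"
  shows "fm_in L \<Theta> (is_iso u A B)"
  unfolding is_iso_def
proof (rule fm_in.ExA)
  have AB: "obj_in L \<Theta> A" "obj_in L \<Theta> B" using arr_in_obj_in[OF assms(2) wf assms(1)] by auto
  then show "obj_in L \<Theta> B" "obj_in L \<Theta> A" by auto
  fix f assume "f \<notin> avars \<Theta>"
  let ?\<Theta> = "\<Theta> @ [Arr f B A]"
  have "arr_in L ?\<Theta> (AVar f) B A" "arr_in L ?\<Theta> u A B" "obj_in L ?\<Theta> A" "obj_in L ?\<Theta> B"
    using assms AB by (auto intro: arr_in.AVar obj_in_append arr_in_append)
  then show "fm_in L ?\<Theta> (aopen 0 (AVar f)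
      (And (Eq (Comp (ABnd 0) u) (Ident A)) (Eq (Comp u (ABnd 0)) (Ident B))))"
    using assms(2) by (auto intro!: fm_in.And fm_in.Eq intro: arr_in.Comp arr_in.Ident)
qed

text \<open>An inverse is given only by an existential quantifier, so it can be named only after
  extending context and hypotheses. The last premise admits an arbitrary extension rather than a
  single fresh variable, which allows eliminations to be iterated.\<close>

lemma sprov_is_isoE:
  assumes "is_ctx L \<Theta>" "arr_in L \<Theta> u A B" "sprov L T \<Theta> H (is_iso u A B)" "fm_in L \<Theta> R"
    "\<And>\<Theta>' H' v. is_ctx L \<Theta>' \<Longrightarrow> set \<Theta> \<subseteq> set \<Theta>' \<Longrightarrow> H \<subseteq> H' \<Longrightarrow> inverse_pair \<Theta>' H' A B u v
      \<Longrightarrow> sprov L T \<Theta>' H' R"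
  shows "sprov L T \<Theta> H R"
  using assms(3)[unfolded is_iso_def] fm_in_is_iso[OF assms(1,2), unfolded is_iso_def] assms(4)
proof (rule sprov_ExAE)
  fix f assume f: "f \<notin> avars \<Theta>"
  have AB: "obj_in L \<Theta> A" "obj_in L \<Theta> B" using arr_in_obj_in[OF assms(2) wf assms(1)] by auto
  let ?\<Theta> = "\<Theta> @ [Arr f B A]"
  let ?Q = "And (Eq (Comp (AVar f) u) (Ident A)) (Eq (Comp u (AVar f)) (Ident B))"
  have ctx: "is_ctx L ?\<Theta>" using assms(1) AB f by (simp add: is_ctx_snoc)
  have arr: "arr_in L ?\<Theta> (AVar f) B A" "arr_in L ?\<Theta> u A B" "obj_in L ?\<Theta> A" "obj_in L ?\<Theta> B"
    using assms AB by (auto intro: arr_in.AVar obj_in_append arr_in_append)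
  have "sprov L T ?\<Theta> (insert ?Q H) ?Q" by (rule sprov_Hyp) simp
  then have "inverse_pair ?\<Theta> (insert ?Q H) A B u (AVar f)"
    using arr ctx by (auto simp: inverse_pair_def eqn_def intro: arr_in.Comp arr_in.Ident
        dest: sprov_AndE1 sprov_AndE2)
  then have "sprov L T ?\<Theta> (insert ?Q H) R"
    using ctx by (intro assms(5)) auto
  then show "sprov L T ?\<Theta> (insert (aopen 0 (AVar f)
      (And (Eq (Comp (ABnd 0) u) (Ident A)) (Eq (Comp u (ABnd 0)) (Ident B)))) H) R"
    using assms(2) by simp
qed

text \<open>Every elimination enlarges the context; hence the induction over \<open>X\<close> leaves
  \<open>\<Theta>\<close> and \<open>H\<close> general, and an inverse already found is carried into
  later extensions by monotonicity.\<close>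

lemma sprov_is_iso_familyE:
  assumes "finite X" "is_ctx L \<Theta>" "fm_in L \<Theta> R"
    "\<And>x. x \<in> X \<Longrightarrow> arr_in L \<Theta> (c x) (A x) (B x)"
    "\<And>x. x \<in> X \<Longrightarrow> sprov L T \<Theta> H (is_iso (c x) (A x) (B x))"
    "\<And>\<Theta>' H' c'. is_ctx L \<Theta>' \<Longrightarrow> set \<Theta> \<subseteq> set \<Theta>' \<Longrightarrow> H \<subseteq> H'
      \<Longrightarrow> (\<And>x. x \<in> X \<Longrightarrow> inverse_pair \<Theta>' H' (A x) (B x) (c x) (c' x)) \<Longrightarrow> sprov L T \<Theta>' H' R"
  shows "sprov L T \<Theta> H R"
  using assms
proof (induction X arbitrary: \<Theta> H rule: finite_induct)
  case empty
  show ?case by (rule empty(5)) (use empty in auto)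
next
  case (insert x X)
  show ?case
  proof (rule sprov_is_isoE[of \<Theta> "c x" "A x" "B x"])
    fix \<Theta>1 H1 v
    assume 1: "is_ctx L \<Theta>1" "set \<Theta> \<subseteq> set \<Theta>1" "H \<subseteq> H1" "inverse_pair \<Theta>1 H1 (A x) (B x) (c x) v"
    show "sprov L T \<Theta>1 H1 R"
    proof (rule insert.IH)
      fix \<Theta>2 H2 c'
      assume 2: "is_ctx L \<Theta>2" "set \<Theta>1 \<subseteq> set \<Theta>2" "H1 \<subseteq> H2"
        "\<And>y. y \<in> X \<Longrightarrow> inverse_pair \<Theta>2 H2 (A y) (B y) (c y) (c' y)"
      have "inverse_pair \<Theta>2 H2 (A x) (B x) (c x) v" using 1 2 by (blast intro: inverse_pair_mono)
      with 2(4) have "inverse_pair \<Theta>2 H2 (A y) (B y) (c y) ((c'(x := v)) y)" if "y \<in> insert x X" for y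
        using that by auto
      moreover have "set \<Theta> \<subseteq> set \<Theta>2" "H \<subseteq> H2" using 1 2 by auto
      ultimately show "sprov L T \<Theta>2 H2 R" using 2(1) by (intro insert.prems(5)) auto
    next
      fix y assume "y \<in> X"
      then show "sprov L T \<Theta>1 H1 (is_iso (c y) (A y) (B y))"
        using 1 by (intro sprov_mono[OF insert.prems(4)]) auto
    qed (use 1 insert.prems in \<open>auto intro: fm_in_mono arr_in_mono\<close>)
  qed (use insert.prems in auto)
qed

text \<open>The hypothesis \<open>f = t\<close> for a fresh variable \<open>f\<close> is harmless because \<open>\<exists>f. f = t\<close> is provable.
  This replaces substitution of terms for arrow variables by renaming.\<close>

lemma sprov_let:
  assumes "is_ctx L \<Theta>" "arr_in L \<Theta> t A B" "fm_in L \<Theta> R"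
    "\<And>f. f \<notin> avars \<Theta> \<Longrightarrow> sprov L T (\<Theta> @ [Arr f A B]) (insert (Eq (AVar f) t) H) R"
  shows "sprov L T \<Theta> H R"
proof -
  have AB: "obj_in L \<Theta> A" "obj_in L \<Theta> B" using arr_in_obj_in[OF assms(2) wf assms(1)] by auto
  have open_t: "aopen 0 u (Eq (ABnd 0) t) = Eq u t" for u using assms(2) by simp
  have fm: "fm_in L \<Theta> (ExA A B (Eq (ABnd 0) t))"
  proof (rule fm_in.ExA)
    fix f
    have "arr_in L (\<Theta> @ [Arr f A B]) (AVar f) A B" "arr_in L (\<Theta> @ [Arr f A B]) t A B"
      using assms(2) by (auto intro: arr_in.AVar arr_in_append)
    then show "fm_in L (\<Theta> @ [Arr f A B]) (aopen 0 (AVar f) (Eq (ABnd 0) t))"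
      unfolding open_t by (rule fm_in.Eq)
  qed (use AB in auto)
  have "sprov L T \<Theta> H (aopen 0 t (Eq (ABnd 0) t))"
    unfolding open_t using eqn_refl[OF assms(1,2)] by (simp add: eqn_def)
  with fm assms(2) have "sprov L T \<Theta> H (ExA A B (Eq (ABnd 0) t))" by (rule sprov_ExAI)
  then show ?thesis using fm assms(3)
    by (rule sprov_ExAE) (unfold open_t, rule assms(4))
qed

end


section \<open>Transport along context isomorphisms\<close>

text \<open>Extends a family of components from variables to object-terms, with f_S = 1_S on
  constants. The value at \<open>OBnd\<close> is chosen to agree with \<open>component\<close>, so
  that \<open>lift_component\<close> holds for every object-term.\<close>

primrec lift :: "(nat \<Rightarrow> ('c, 'a) arr) \<Rightarrow> 'c obj \<Rightarrow> ('c, 'a) arr" where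
  "lift c (OCon k) = Ident (OCon k)"
| "lift c (OVar x) = c x"
| "lift c (OBnd i) = Ident (OBnd i)"

lemma lift_upd: "obj_in L \<Psi> A \<Longrightarrow> x \<notin> ovars \<Psi> \<Longrightarrow> lift (c(x := u)) A = lift c A"
  by (auto elim: obj_in.cases)

context category_theory
begin

text \<open>The invariant of the main induction. The inverses \<open>c'\<close> are part of the data
  so that conjugates can be written as terms. The squares are provable only under \<open>H\<close>,
  which comes to include the isomorphism conditions and the defining equations of named
  arrows.\<close>

definition ctx_rel ::
  "'c ctx \<Rightarrow> 'c ctx \<Rightarrow> ('c, 'a) fm set \<Rightarrow> (nat \<Rightarrow> nat) \<Rightarrow> (nat \<Rightarrow> nat) \<Rightarrow> (nat \<Rightarrow> nat) \<Rightarrow> (nat \<Rightarrow> nat)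
    \<Rightarrow> (nat \<Rightarrow> ('c, 'a) arr) \<Rightarrow> (nat \<Rightarrow> ('c, 'a) arr) \<Rightarrow> bool" where
  "ctx_rel \<Psi> \<Theta> H r1 s1 r2 s2 c c' \<longleftrightarrow>
    is_ctx L \<Theta> \<and> ctx_map L \<Psi> \<Theta> r1 s1 \<and> ctx_map L \<Psi> \<Theta> r2 s2 \<and>
    (\<forall>x \<in> ovars \<Psi>. inverse_pair \<Theta> H (OVar (r1 x)) (OVar (r2 x)) (c x) (c' x)) \<and>
    (\<forall>g A B. Arr g A B \<in> set \<Psi> \<longrightarrow> eqn \<Theta> H (rename_obj r1 A) (rename_obj r2 B)
      (Comp (AVar (s2 g)) (lift c A)) (Comp (lift c B) (AVar (s1 g))))"

lemma ctx_rel_mono: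
  "ctx_rel \<Psi> \<Theta> H r1 s1 r2 s2 c c' \<Longrightarrow> is_ctx L \<Theta>' \<Longrightarrow> set \<Theta> \<subseteq> set \<Theta>' \<Longrightarrow> H \<subseteq> H'
    \<Longrightarrow> ctx_rel \<Psi> \<Theta>' H' r1 s1 r2 s2 c c'"
  unfolding ctx_rel_def by (blast intro: ctx_map_mono inverse_pair_mono eqn_mono)

lemma ctx_rel_lift:
  assumes "ctx_rel \<Psi> \<Theta> H r1 s1 r2 s2 c c'" "obj_in L \<Psi> A"
  shows "inverse_pair \<Theta> H (rename_obj r1 A) (rename_obj r2 A) (lift c A) (lift c' A)"
  using assms(2)
proof cases
  case (OCon k)
  then show ?thesis using assms inverse_pair_Ident[of \<Theta> A]
    by (auto simp: ctx_rel_def intro: obj_in.OCon)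
next
  case (OVar x)
  then show ?thesis using assms by (auto simp: ctx_rel_def)
qed

lemma ctx_rel_sym:
  assumes "ctx_rel \<Psi> \<Theta> H r1 s1 r2 s2 c c'"
  shows "ctx_rel \<Psi> \<Theta> H r2 s2 r1 s1 c' c"
  unfolding ctx_rel_def
proof (intro conjI ballI allI impI)
  show "is_ctx L \<Theta>" "ctx_map L \<Psi> \<Theta> r2 s2" "ctx_map L \<Psi> \<Theta> r1 s1"
    using assms by (auto simp: ctx_rel_def)
next
  fix x assume "x \<in> ovars \<Psi>"
  then show "inverse_pair \<Theta> H (OVar (r2 x)) (OVar (r1 x)) (c' x) (c x)"
    using assms by (auto simp: ctx_rel_def intro: inverse_pair_sym)
next
  fix g A B assume g: "Arr g A B \<in> set \<Psi>"
  then have AB: "obj_in L \<Psi> A" "obj_in L \<Psi> B" using assms by (auto simp: ctx_rel_def ctx_map_def)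
  show "eqn \<Theta> H (rename_obj r2 A) (rename_obj r1 B)
      (Comp (AVar (s1 g)) (lift c' A)) (Comp (lift c' B) (AVar (s2 g)))"
    using ctx_rel_lift[OF assms AB(1)] ctx_rel_lift[OF assms AB(2)]
    by (rule eqn_inverse_square)
      (use assms g in \<open>auto simp: ctx_rel_def ctx_map_def intro: arr_in.AVar\<close>)
qed

text \<open>Naturality of the components. For constants and identities it reduces to the unit laws,
  for variables it belongs to the invariant, and for a composite the two squares are pasted along
  the component at the middle object.\<close>

lemma ctx_rel_arr:
  assumes "arr_in L \<Psi> t A B" "ctx_rel \<Psi> \<Theta> H r1 s1 r2 s2 c c'" "is_ctx L \<Psi>"
  shows "eqn \<Theta> H (rename_obj r1 A) (rename_obj r2 B)
    (Comp (rename_arr r2 s2 t) (lift c A)) (Comp (lift c B) (rename_arr r1 s1 t))"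
  using assms(1)
proof (induction rule: arr_in.induct)
  case (ACon a)
  have "is_ctx L \<Theta>" using assms(2) by (simp add: ctx_rel_def)
  moreover have "arr_in L \<Theta> (ACon a) (OCon (src L a)) (OCon (tgt L a))"
    using ACon by (rule arr_in.ACon)
  ultimately show ?case by (simp add: eqn_Ident_swap)
next
  case (AVar f A B)
  then show ?case using assms(2) by (auto simp: ctx_rel_def)
next
  case (Ident A)
  have "is_ctx L \<Theta>" using assms(2) by (simp add: ctx_rel_def)
  moreover have "arr_in L \<Theta> (lift c A) (rename_obj r1 A) (rename_obj r2 A)"
    using ctx_rel_lift[OF assms(2) Ident] by (simp add: inverse_pair_def)
  ultimately show ?case by (simp add: eqn_sym[OF eqn_Ident_swap])
next
  case (Comp s A B t C)
  have ctx: "is_ctx L \<Theta>" "ctx_map L \<Psi> \<Theta> r1 s1" "ctx_map L \<Psi> \<Theta> r2 s2"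
    using assms(2) by (auto simp: ctx_rel_def)
  note s = arr_in_ctx_map[OF Comp.hyps(1) ctx(2)] arr_in_ctx_map[OF Comp.hyps(1) ctx(3)]
  note t = arr_in_ctx_map[OF Comp.hyps(2) ctx(2)] arr_in_ctx_map[OF Comp.hyps(2) ctx(3)]
  have l: "arr_in L \<Theta> (lift c D) (rename_obj r1 D) (rename_obj r2 D)" if "obj_in L \<Psi> D" for D
    using ctx_rel_lift[OF assms(2) that] by (simp add: inverse_pair_def)
  note l = l[OF arr_in_obj_in(1)[OF Comp.hyps(1) wf assms(3)]]
    l[OF arr_in_obj_in(1)[OF Comp.hyps(2) wf assms(3)]] l[OF arr_in_obj_in(2)[OF Comp.hyps(2) wf assms(3)]]
  let ?s1 = "rename_arr r1 s1 s" and ?s2 = "rename_arr r2 s2 s"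
  let ?t1 = "rename_arr r1 s1 t" and ?t2 = "rename_arr r2 s2 t"
  let ?A = "rename_obj r1 A" and ?C = "rename_obj r2 C"
  have "eqn \<Theta> H ?A ?C (Comp (Comp ?t2 ?s2) (lift c A)) (Comp ?t2 (Comp ?s2 (lift c A)))"
    using ctx s t l by (blast intro: eqn_sym eqn_assoc)
  also have "eqn \<Theta> H ?A ?C (Comp ?t2 (Comp ?s2 (lift c A))) (Comp ?t2 (Comp (lift c B) ?s1))"
    using ctx s t l Comp.IH by (blast intro: eqn_Comp eqn_refl)
  also have "eqn \<Theta> H ?A ?C (Comp ?t2 (Comp (lift c B) ?s1)) (Comp (Comp ?t2 (lift c B)) ?s1)"
    using ctx s t l by (blast intro: eqn_assoc)
  also have "eqn \<Theta> H ?A ?C (Comp (Comp ?t2 (lift c B)) ?s1) (Comp (Comp (lift c C) ?t1) ?s1)"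
    using ctx s t l Comp.IH by (blast intro: eqn_Comp eqn_refl)
  also have "eqn \<Theta> H ?A ?C (Comp (Comp (lift c C) ?t1) ?s1) (Comp (lift c C) (Comp ?t1 ?s1))"
    using ctx s t l by (blast intro: eqn_sym eqn_assoc)
  finally show ?case by simp
qed

text \<open>The squares of earlier arrows survive because their sorts lie in \<open>\<Psi>\<close>
  and so do not mention \<open>x\<close>.\<close>

lemma ctx_rel_Obj:
  assumes "ctx_rel \<Psi> \<Theta> H r1 s1 r2 s2 c c'" "x \<notin> ovars \<Psi>" "y \<notin> ovars \<Theta>"
  shows "ctx_rel (\<Psi> @ [Obj x]) (\<Theta> @ [Obj y]) H (r1(x := y)) s1 (r2(x := y)) s2
    (c(x := Ident (OVar y))) (c'(x := Ident (OVar y)))"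
proof -
  let ?\<Theta> = "\<Theta> @ [Obj y]"
  have ctx: "is_ctx L ?\<Theta>" using assms by (simp add: ctx_rel_def is_ctx_snoc)
  have rel: "ctx_rel \<Psi> ?\<Theta> H r1 s1 r2 s2 c c'"
    using assms(1) ctx by (rule ctx_rel_mono) auto
  have y: "inverse_pair ?\<Theta> H (OVar y) (OVar y) (Ident (OVar y)) (Ident (OVar y))"
    using ctx by (rule inverse_pair_Ident) (auto intro: obj_in.OVar)
  show ?thesis
    unfolding ctx_rel_def
  proof (intro conjI ballI allI impI)
    show "is_ctx L ?\<Theta>" by (rule ctx)
    show "ctx_map L (\<Psi> @ [Obj x]) ?\<Theta> (r1(x := y)) s1" "ctx_map L (\<Psi> @ [Obj x]) ?\<Theta> (r2(x := y)) s2"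
      using assms by (auto simp: ctx_rel_def simp del: fun_upd_apply intro!: ctx_map_Obj)
  next
    fix z assume "z \<in> ovars (\<Psi> @ [Obj x])"
    then show "inverse_pair ?\<Theta> H (OVar ((r1(x := y)) z)) (OVar ((r2(x := y)) z))
        ((c(x := Ident (OVar y))) z) ((c'(x := Ident (OVar y))) z)"
      using rel y by (auto simp: ctx_rel_def)
  next
    fix g A B assume "Arr g A B \<in> set (\<Psi> @ [Obj x])"
    then have g: "Arr g A B \<in> set \<Psi>" by simp
    then have "obj_in L \<Psi> A" "obj_in L \<Psi> B" using assms by (auto simp: ctx_rel_def ctx_map_def)
    then show "eqn ?\<Theta> H (rename_obj (r1(x := y)) A) (rename_obj (r2(x := y)) B)
      (Comp (AVar (s2 g)) (lift (c(x := Ident (OVar y))) A))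
      (Comp (lift (c(x := Ident (OVar y))) B) (AVar (s1 g)))"
      using rel g assms(2) by (simp add: ctx_rel_def rename_obj_upd lift_upd del: fun_upd_apply)
  qed
qed

lemma ctx_rel_Arr:
  assumes "ctx_rel \<Psi> \<Theta> H r1 s1 r2 s2 c c'" "f \<notin> avars \<Psi>" "obj_in L \<Psi> A" "obj_in L \<Psi> B"
    "Arr g1 (rename_obj r1 A) (rename_obj r1 B) \<in> set \<Theta>"
    "Arr g2 (rename_obj r2 A) (rename_obj r2 B) \<in> set \<Theta>"
    "eqn \<Theta> H (rename_obj r1 A) (rename_obj r2 B)
      (Comp (AVar g2) (lift c A)) (Comp (lift c B) (AVar g1))"
  shows "ctx_rel (\<Psi> @ [Arr f A B]) \<Theta> H r1 (s1(f := g1)) r2 (s2(f := g2)) c c'"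
  unfolding ctx_rel_def
proof (intro conjI ballI allI impI)
  show "is_ctx L \<Theta>" using assms by (simp add: ctx_rel_def)
  show "ctx_map L (\<Psi> @ [Arr f A B]) \<Theta> r1 (s1(f := g1))"
    by (rule ctx_map_Arr[where \<Theta> = \<Theta>]) (use assms in \<open>auto simp: ctx_rel_def\<close>)
  show "ctx_map L (\<Psi> @ [Arr f A B]) \<Theta> r2 (s2(f := g2))"
    by (rule ctx_map_Arr[where \<Theta> = \<Theta>]) (use assms in \<open>auto simp: ctx_rel_def\<close>)
next
  fix x assume "x \<in> ovars (\<Psi> @ [Arr f A B])"
  then show "inverse_pair \<Theta> H (OVar (r1 x)) (OVar (r2 x)) (c x) (c' x)"
    using assms by (simp add: ctx_rel_def)
next
  fix k C D assume "Arr k C D \<in> set (\<Psi> @ [Arr f A B])"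
  then have "(k = f \<and> C = A \<and> D = B) \<or> (k \<noteq> f \<and> Arr k C D \<in> set \<Psi>)"
    using assms(2) by (auto simp: avars_def)
  then show "eqn \<Theta> H (rename_obj r1 C) (rename_obj r2 D)
      (Comp (AVar ((s2(f := g2)) k)) (lift c C)) (Comp (lift c D) (AVar ((s1(f := g1)) k)))"
    using assms by (auto simp: ctx_rel_def)
qed

text \<open>The ambient context and the hypotheses vary in the induction because quantifiers add
  variables and defining equations; the two interpretations vary because they are extended at
  quantifiers and exchanged in the premise of an implication.\<close>

lemma sprov_transport:
  assumes "fm_in L \<Psi> P" "is_ctx L \<Psi>" "ctx_rel \<Psi> \<Theta> H r1 s1 r2 s2 c c'"
  shows "sprov L T \<Theta> H (Imp (rename r1 s1 P) (rename r2 s2 P))"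
  using assms
proof (induction arbitrary: \<Theta> H r1 s1 r2 s2 c c' rule: fm_in.induct)
  case (Eq \<Psi> t A B u)
  note rel = Eq.prems(2)
  have maps: "is_ctx L \<Theta>" "ctx_map L \<Psi> \<Theta> r1 s1" "ctx_map L \<Psi> \<Theta> r2 s2"
    using rel by (auto simp: ctx_rel_def)
  let ?t1 = "rename_arr r1 s1 t" and ?t2 = "rename_arr r2 s2 t"
  let ?u1 = "rename_arr r1 s1 u" and ?u2 = "rename_arr r2 s2 u"
  let ?A1 = "rename_obj r1 A" and ?A2 = "rename_obj r2 A"
  let ?B1 = "rename_obj r1 B" and ?B2 = "rename_obj r2 B"
  let ?H = "insert (Eq ?t1 ?u1) H"
  have arr: "arr_in L \<Theta> ?t1 ?A1 ?B1" "arr_in L \<Theta> ?t2 ?A2 ?B2" "arr_in L \<Theta> ?u1 ?A1 ?B1"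
    "arr_in L \<Theta> ?u2 ?A2 ?B2"
    using Eq.hyps maps by (auto intro: arr_in_ctx_map)
  have rel': "ctx_rel \<Psi> \<Theta> ?H r1 s1 r2 s2 c c'" using rel maps(1) by (rule ctx_rel_mono) auto
  note a = ctx_rel_lift[OF rel' arr_in_obj_in(1)[OF Eq.hyps(1) wf Eq.prems(1)]]
  note b = ctx_rel_lift[OF rel' arr_in_obj_in(2)[OF Eq.hyps(1) wf Eq.prems(1)]]
  note ab = a[unfolded inverse_pair_def] b[unfolded inverse_pair_def]
  note t = ctx_rel_arr[OF Eq.hyps(1) rel' Eq.prems(1)]
  note u = ctx_rel_arr[OF Eq.hyps(2) rel' Eq.prems(1)]
  have tu: "eqn \<Theta> ?H ?A1 ?B1 ?t1 ?u1" using arr maps(1) by (simp add: eqn_def sprov_Hyp)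
  \<comment> \<open>Write t2 as (t2 f_A) composed with the inverse of f_A, trade t2 f_A for f_B t1,
    replace t1 by u1, and return in the same way to u2.\<close>
  have "eqn \<Theta> ?H ?A2 ?B2 ?t2 (Comp (Comp ?t2 (lift c A)) (lift c' A))"
    using a arr(2) by (rule eqn_sym[OF eqn_cancel_right])
  also have "eqn \<Theta> ?H ?A2 ?B2 \<dots> (Comp (Comp (lift c B) ?t1) (lift c' A))"
    using t ab maps(1) by (blast intro: eqn_Comp eqn_refl)
  also have "eqn \<Theta> ?H ?A2 ?B2 \<dots> (Comp (Comp (lift c B) ?u1) (lift c' A))"
    using tu ab maps(1) by (blast intro: eqn_Comp eqn_refl)
  also have "eqn \<Theta> ?H ?A2 ?B2 \<dots> (Comp (Comp ?u2 (lift c A)) (lift c' A))"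
    using u ab maps(1) by (blast intro: eqn_Comp eqn_refl eqn_sym)
  also have "eqn \<Theta> ?H ?A2 ?B2 \<dots> ?u2"
    using a arr(4) by (rule eqn_cancel_right)
  finally have "sprov L T \<Theta> ?H (Eq ?t2 ?u2)" by (simp add: eqn_def)
  then show ?case using arr by (auto intro: sprov_ImpI fm_in.Eq)
next
  case (Bot \<Psi>)
  show ?case by (auto intro: sprov_ImpI fm_in.Bot sprov_Hyp)
next
  case (And \<Psi> P Q)
  let ?P1 = "rename r1 s1 (And P Q)"
  have fm: "fm_in L \<Theta> ?P1"
    using fm_in_ctx_map[OF fm_in.And[OF And.hyps]] And.prems(2) by (simp add: ctx_rel_def)
  have "sprov L T \<Theta> (insert ?P1 H) ?P1" by (rule sprov_Hyp) simp
  then have hyp: "sprov L T \<Theta> (insert ?P1 H) (And (rename r1 s1 P) (rename r1 s1 Q))" by simp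
  have "sprov L T \<Theta> (insert ?P1 H) (rename r2 s2 P)" "sprov L T \<Theta> (insert ?P1 H) (rename r2 s2 Q)"
    using sprov_ImpE[OF sprov_mono[OF And.IH(1)[OF And.prems]] sprov_AndE1[OF hyp]]
      sprov_ImpE[OF sprov_mono[OF And.IH(2)[OF And.prems]] sprov_AndE2[OF hyp]] by auto
  then have "sprov L T \<Theta> (insert ?P1 H) (rename r2 s2 (And P Q))" by (simp add: sprov_AndI)
  with fm show ?case by (rule sprov_ImpI)
next
  case (Or \<Psi> P Q)
  let ?P1 = "rename r1 s1 (Or P Q)"
  have maps: "ctx_map L \<Psi> \<Theta> r1 s1" "ctx_map L \<Psi> \<Theta> r2 s2"
    using Or.prems(2) by (auto simp: ctx_rel_def)
  note P = fm_in_ctx_map[OF Or.hyps(1) maps(1)] fm_in_ctx_map[OF Or.hyps(1) maps(2)]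
  note Q = fm_in_ctx_map[OF Or.hyps(2) maps(1)] fm_in_ctx_map[OF Or.hyps(2) maps(2)]
  have "sprov L T \<Theta> (insert ?P1 H) ?P1" by (rule sprov_Hyp) simp
  then have hyp: "sprov L T \<Theta> (insert ?P1 H) (Or (rename r1 s1 P) (rename r1 s1 Q))" by simp
  have "sprov L T \<Theta> (insert ?P1 H) (Or (rename r2 s2 P) (rename r2 s2 Q))"
    using hyp P(1) Q(1)
  proof (rule sprov_OrE)
    show "sprov L T \<Theta> (insert (rename r1 s1 P) (insert ?P1 H)) (Or (rename r2 s2 P) (rename r2 s2 Q))"
      using Q(2) by (intro sprov_OrI1 sprov_ImpE[OF sprov_mono[OF Or.IH(1)[OF Or.prems]] sprov_Hyp]) auto
    show "sprov L T \<Theta> (insert (rename r1 s1 Q) (insert ?P1 H)) (Or (rename r2 s2 P) (rename r2 s2 Q))"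
      using P(2) by (intro sprov_OrI2 sprov_ImpE[OF sprov_mono[OF Or.IH(2)[OF Or.prems]] sprov_Hyp]) auto
  qed
  then show ?case using P(1) Q(1) by (auto intro: sprov_ImpI fm_in.Or)
next
  case (Imp \<Psi> P Q)
  let ?P1 = "rename r1 s1 (Imp P Q)"
  have maps: "ctx_map L \<Psi> \<Theta> r1 s1" "ctx_map L \<Psi> \<Theta> r2 s2"
    using Imp.prems(2) by (auto simp: ctx_rel_def)
  let ?H = "insert (rename r2 s2 P) (insert ?P1 H)"
  have "sprov L T \<Theta> ?H (rename r2 s2 P)" "sprov L T \<Theta> ?H ?P1" by (auto intro: sprov_Hyp)
  \<comment> \<open>The premise is contravariant: it is transported from the second interpretation
    to the first, along the reversed relation.\<close>
  moreover have "sprov L T \<Theta> ?H (Imp (rename r2 s2 P) (rename r1 s1 P))"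
    using Imp.IH(1)[OF Imp.prems(1) ctx_rel_sym[OF Imp.prems(2)]] by (rule sprov_mono) auto
  moreover have "sprov L T \<Theta> ?H (Imp (rename r1 s1 Q) (rename r2 s2 Q))"
    using Imp.IH(2)[OF Imp.prems] by (rule sprov_mono) auto
  ultimately have "sprov L T \<Theta> ?H (rename r2 s2 Q)" unfolding rename.simps by (blast intro: sprov_ImpE)
  then show ?case
    using fm_in_ctx_map[OF fm_in.Imp[OF Imp.hyps] maps(1)] fm_in_ctx_map[OF Imp.hyps(1) maps(2)]
    by (auto intro: sprov_ImpI)
next
  case (AllO \<Psi> P)
  let ?P1 = "rename r1 s1 (AllO P)" and ?P2 = "rename r2 s2 (AllO P)"
  have maps: "is_ctx L \<Theta>" "ctx_map L \<Psi> \<Theta> r1 s1" "ctx_map L \<Psi> \<Theta> r2 s2"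
    using AllO.prems(2) by (auto simp: ctx_rel_def)
  note fm = fm_in_ctx_map[OF fm_in.AllO[OF AllO.hyps] maps(2)]
    fm_in_ctx_map[OF fm_in.AllO[OF AllO.hyps] maps(3)]
  obtain x where x: "x \<notin> ovars \<Psi>" "x \<notin> ofv P" using ex_fresh_ovar by blast
  have "sprov L T \<Theta> (insert ?P1 H) ?P2"
    unfolding rename.simps
  proof (rule sprov_AllOI[OF fm(2)[unfolded rename.simps]])
    fix y assume y: "y \<notin> ovars \<Theta>"
    let ?\<Theta> = "\<Theta> @ [Obj y]"
    have "sprov L T ?\<Theta> H (Imp (oopen 0 (OVar y) (rename r1 s1 P)) (oopen 0 (OVar y) (rename r2 s2 P)))"
      unfolding rename_oopen_fresh[OF x(2), symmetric]
      by (rule AllO.IH[OF x(1) _ ctx_rel_Obj[OF AllO.prems(2) x(1) y]])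
        (simp add: is_ctx_snoc AllO.prems(1) x(1))
    then have "sprov L T ?\<Theta> (insert (AllO (rename r1 s1 P)) H)
        (Imp (oopen 0 (OVar y) (rename r1 s1 P)) (oopen 0 (OVar y) (rename r2 s2 P)))"
      by (rule sprov_mono) auto
    moreover have "sprov L T ?\<Theta> (insert (AllO (rename r1 s1 P)) H) (oopen 0 (OVar y) (rename r1 s1 P))"
      by (rule sprov_AllOE[OF sprov_Hyp]) (auto intro: obj_in.OVar)
    ultimately show "sprov L T ?\<Theta> (insert (AllO (rename r1 s1 P)) H) (oopen 0 (OVar y) (rename r2 s2 P))"
      by (rule sprov_ImpE)
  qed
  with fm(1) show ?case by (rule sprov_ImpI)
next
  case (ExO \<Psi> P)
  let ?P1 = "rename r1 s1 (ExO P)" and ?P2 = "rename r2 s2 (ExO P)"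
  have maps: "is_ctx L \<Theta>" "ctx_map L \<Psi> \<Theta> r1 s1" "ctx_map L \<Psi> \<Theta> r2 s2"
    using ExO.prems(2) by (auto simp: ctx_rel_def)
  note fm = fm_in_ctx_map[OF fm_in.ExO[OF ExO.hyps] maps(2)]
    fm_in_ctx_map[OF fm_in.ExO[OF ExO.hyps] maps(3)]
  obtain x where x: "x \<notin> ovars \<Psi>" "x \<notin> ofv P" using ex_fresh_ovar by blast
  have "sprov L T \<Theta> (insert ?P1 H) (ExO (rename r1 s1 P))" by (rule sprov_Hyp) simp
  then have "sprov L T \<Theta> (insert ?P1 H) ?P2"
  proof (rule sprov_ExOE[OF _ fm(1)[unfolded rename.simps] fm(2)])
    fix y assume y: "y \<notin> ovars \<Theta>"
    let ?\<Theta> = "\<Theta> @ [Obj y]"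
    let ?H = "insert (oopen 0 (OVar y) (rename r1 s1 P)) (insert ?P1 H)"
    have "sprov L T ?\<Theta> H (Imp (oopen 0 (OVar y) (rename r1 s1 P)) (oopen 0 (OVar y) (rename r2 s2 P)))"
      unfolding rename_oopen_fresh[OF x(2), symmetric]
      by (rule ExO.IH[OF x(1) _ ctx_rel_Obj[OF ExO.prems(2) x(1) y]])
        (simp add: is_ctx_snoc ExO.prems(1) x(1))
    then have "sprov L T ?\<Theta> ?H
        (Imp (oopen 0 (OVar y) (rename r1 s1 P)) (oopen 0 (OVar y) (rename r2 s2 P)))"
      by (rule sprov_mono) auto
    moreover have "sprov L T ?\<Theta> ?H (oopen 0 (OVar y) (rename r1 s1 P))"
      by (rule sprov_Hyp) simp
    ultimately have "sprov L T ?\<Theta> ?H (oopen 0 (OVar y) (rename r2 s2 P))"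
      by (rule sprov_ImpE)
    then show "sprov L T ?\<Theta> ?H ?P2"
      unfolding rename.simps
      by (intro sprov_ExOI[OF fm_in_append[OF fm(2)[unfolded rename.simps]]]) (auto intro: obj_in.OVar)
  qed
  with fm(1) show ?case by (rule sprov_ImpI)
next
  case (AllA \<Psi> A B P)
  let ?P1 = "rename r1 s1 (AllA A B P)" and ?P2 = "rename r2 s2 (AllA A B P)"
  let ?A1 = "rename_obj r1 A" and ?A2 = "rename_obj r2 A"
  let ?B1 = "rename_obj r1 B" and ?B2 = "rename_obj r2 B"
  have maps: "is_ctx L \<Theta>" "ctx_map L \<Psi> \<Theta> r1 s1" "ctx_map L \<Psi> \<Theta> r2 s2"
    using AllA.prems(2) by (auto simp: ctx_rel_def)
  note fm = fm_in_ctx_map[OF fm_in.AllA[OF AllA.hyps] maps(2)]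
    fm_in_ctx_map[OF fm_in.AllA[OF AllA.hyps] maps(3)]
  note obj = obj_in_ctx_map[OF AllA.hyps(1) maps(2)] obj_in_ctx_map[OF AllA.hyps(2) maps(2)]
    obj_in_ctx_map[OF AllA.hyps(1) maps(3)] obj_in_ctx_map[OF AllA.hyps(2) maps(3)]
  obtain f where f: "f \<notin> avars \<Psi>" "f \<notin> afv P" using ex_fresh_avar by blast
  have "sprov L T \<Theta> (insert ?P1 H) ?P2"
    unfolding rename.simps
  proof (rule sprov_AllAI[OF fm(2)[unfolded rename.simps]])
    fix f2 assume f2: "f2 \<notin> avars \<Theta>"
    let ?\<Theta> = "\<Theta> @ [Arr f2 ?A2 ?B2]"
    let ?H = "insert (AllA ?A1 ?B1 (rename r1 s1 P)) H"
    \<comment> \<open>The arrow from A1 to B1 that corresponds to \<open>f2\<close>: applying the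
      inverse of f_B to both sides of f_B t = f2 f_A leaves only this choice. It is the instance at
      which the universal hypothesis will be used, under the name \<open>f1\<close>.\<close>
    let ?t = "Comp (lift c' B) (Comp (AVar f2) (lift c A))"
    have ctx: "is_ctx L ?\<Theta>" using maps(1) f2 obj by (simp add: is_ctx_snoc)
    have rel: "ctx_rel \<Psi> ?\<Theta> ?H r1 s1 r2 s2 c c'" using AllA.prems(2) ctx by (rule ctx_rel_mono) auto
    note inv = ctx_rel_lift[OF rel AllA.hyps(1)] ctx_rel_lift[OF rel AllA.hyps(2)]
    have f2_arr: "arr_in L ?\<Theta> (AVar f2) ?A2 ?B2" by (rule arr_in.AVar) simp
    then have f2_lift: "arr_in L ?\<Theta> (Comp (AVar f2) (lift c A)) ?A1 ?B2"
      using inv by (auto simp: inverse_pair_def intro: arr_in.Comp)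
    then have t: "arr_in L ?\<Theta> ?t ?A1 ?B1"
      using inv by (auto simp: inverse_pair_def intro: arr_in.Comp)
    have fm2: "fm_in L ?\<Theta> (aopen 0 (AVar f2) (rename r2 s2 P))"
      using fm(2) f2 unfolding rename.simps by (blast elim: fm_in_AllA)
    show "sprov L T ?\<Theta> ?H (aopen 0 (AVar f2) (rename r2 s2 P))"
      using ctx t fm2
    proof (rule sprov_let)
      fix f1 assume f1: "f1 \<notin> avars ?\<Theta>"
      let ?\<Theta>1 = "?\<Theta> @ [Arr f1 ?A1 ?B1]" and ?H1 = "insert (Eq (AVar f1) ?t) ?H"
      have ctx1: "is_ctx L ?\<Theta>1"
        by (rule is_ctx.Arr[OF ctx obj_in_append[OF obj(1)] obj_in_append[OF obj(2)] f1])
      have rel1: "ctx_rel \<Psi> ?\<Theta>1 ?H1 r1 s1 r2 s2 c c'" using rel ctx1 by (rule ctx_rel_mono) auto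
      note inv1 = ctx_rel_lift[OF rel1 AllA.hyps(1)] ctx_rel_lift[OF rel1 AllA.hyps(2)]
      have f1_arr: "arr_in L ?\<Theta>1 (AVar f1) ?A1 ?B1" by (rule arr_in.AVar) simp
      have eq: "eqn ?\<Theta>1 ?H1 ?A1 ?B1 (AVar f1) ?t"
        using ctx1 f1_arr arr_in_append[OF t] by (simp add: eqn_def sprov_Hyp)
      have "arr_in L ?\<Theta>1 (lift c B) ?B1 ?B2" using inv1 by (simp add: inverse_pair_def)
      then have "eqn ?\<Theta>1 ?H1 ?A1 ?B2 (Comp (lift c B) (AVar f1)) (Comp (lift c B) ?t)"
        using eq ctx1 by (blast intro: eqn_Comp eqn_refl)
      also have "eqn ?\<Theta>1 ?H1 ?A1 ?B2 \<dots> (Comp (AVar f2) (lift c A))"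
        using inverse_pair_sym[OF inv1(2)] arr_in_append[OF f2_lift] by (rule eqn_cancel_left)
      finally have sq: "eqn ?\<Theta>1 ?H1 ?A1 ?B2 (Comp (AVar f2) (lift c A)) (Comp (lift c B) (AVar f1))"
        by (rule eqn_sym)
      have "sprov L T ?\<Theta>1 ?H1 (Imp (aopen 0 (AVar f1) (rename r1 s1 P)) (aopen 0 (AVar f2) (rename r2 s2 P)))"
        unfolding rename_aopen_fresh[OF f(2), symmetric]
      proof (rule AllA.IH[OF f(1)])
        show "is_ctx L (\<Psi> @ [Arr f A B])" using AllA.prems(1) AllA.hyps f by (simp add: is_ctx_snoc)
        show "ctx_rel (\<Psi> @ [Arr f A B]) ?\<Theta>1 ?H1 r1 (s1(f := f1)) r2 (s2(f := f2)) c c'"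
          using rel1 f(1) AllA.hyps(1,2) _ _ sq by (rule ctx_rel_Arr) auto
      qed
      moreover have "sprov L T ?\<Theta>1 ?H1 (aopen 0 (AVar f1) (rename r1 s1 P))"
        using f1_arr by (rule sprov_AllAE[OF sprov_Hyp, rotated]) simp
      ultimately show "sprov L T ?\<Theta>1 ?H1 (aopen 0 (AVar f2) (rename r2 s2 P))" by (rule sprov_ImpE)
    qed
  qed
  with fm(1) show ?case by (rule sprov_ImpI)
next
  case (ExA \<Psi> A B P)
  let ?P1 = "rename r1 s1 (ExA A B P)" and ?P2 = "rename r2 s2 (ExA A B P)"
  let ?A1 = "rename_obj r1 A" and ?A2 = "rename_obj r2 A"
  let ?B1 = "rename_obj r1 B" and ?B2 = "rename_obj r2 B"
  have maps: "is_ctx L \<Theta>" "ctx_map L \<Psi> \<Theta> r1 s1" "ctx_map L \<Psi> \<Theta> r2 s2"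
    using ExA.prems(2) by (auto simp: ctx_rel_def)
  note fm = fm_in_ctx_map[OF fm_in.ExA[OF ExA.hyps] maps(2)]
    fm_in_ctx_map[OF fm_in.ExA[OF ExA.hyps] maps(3)]
  note obj = obj_in_ctx_map[OF ExA.hyps(1) maps(2)] obj_in_ctx_map[OF ExA.hyps(2) maps(2)]
    obj_in_ctx_map[OF ExA.hyps(1) maps(3)] obj_in_ctx_map[OF ExA.hyps(2) maps(3)]
  obtain f where f: "f \<notin> avars \<Psi>" "f \<notin> afv P" using ex_fresh_avar by blast
  have "sprov L T \<Theta> (insert ?P1 H) (ExA ?A1 ?B1 (rename r1 s1 P))" by (rule sprov_Hyp) simp
  then have "sprov L T \<Theta> (insert ?P1 H) ?P2"
  proof (rule sprov_ExAE[OF _ fm(1)[unfolded rename.simps] fm(2)])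
    fix f1 assume f1: "f1 \<notin> avars \<Theta>"
    let ?\<Theta> = "\<Theta> @ [Arr f1 ?A1 ?B1]"
    let ?H = "insert (aopen 0 (AVar f1) (rename r1 s1 P)) (insert ?P1 H)"
    \<comment> \<open>The witness \<open>f1\<close> is conjugated in the opposite direction, so that
      composing with f_A on the right gives back f_B f1.\<close>
    let ?t = "Comp (Comp (lift c B) (AVar f1)) (lift c' A)"
    have ctx: "is_ctx L ?\<Theta>" using maps(1) f1 obj by (simp add: is_ctx_snoc)
    have rel: "ctx_rel \<Psi> ?\<Theta> ?H r1 s1 r2 s2 c c'" using ExA.prems(2) ctx by (rule ctx_rel_mono) auto
    note inv = ctx_rel_lift[OF rel ExA.hyps(1)] ctx_rel_lift[OF rel ExA.hyps(2)]
    have f1_arr: "arr_in L ?\<Theta> (AVar f1) ?A1 ?B1" by (rule arr_in.AVar) simp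
    then have f1_lift: "arr_in L ?\<Theta> (Comp (lift c B) (AVar f1)) ?A1 ?B2"
      using inv by (auto simp: inverse_pair_def intro: arr_in.Comp)
    then have t: "arr_in L ?\<Theta> ?t ?A2 ?B2"
      using inv by (auto simp: inverse_pair_def intro: arr_in.Comp)
    \<comment> \<open>The goal remains the quantified formula: \<open>sprov_let\<close> demands a
      conclusion well-sorted before the name \<open>f2\<close> is introduced, so the existential
      introduction has to take place inside it.\<close>
    show "sprov L T ?\<Theta> ?H ?P2"
      using ctx t fm_in_append[OF fm(2)]
    proof (rule sprov_let)
      fix f2 assume f2: "f2 \<notin> avars ?\<Theta>"
      let ?\<Theta>2 = "?\<Theta> @ [Arr f2 ?A2 ?B2]" and ?H2 = "insert (Eq (AVar f2) ?t) ?H"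
      have ctx2: "is_ctx L ?\<Theta>2"
        by (rule is_ctx.Arr[OF ctx obj_in_append[OF obj(3)] obj_in_append[OF obj(4)] f2])
      have rel2: "ctx_rel \<Psi> ?\<Theta>2 ?H2 r1 s1 r2 s2 c c'" using rel ctx2 by (rule ctx_rel_mono) auto
      note inv2 = ctx_rel_lift[OF rel2 ExA.hyps(1)] ctx_rel_lift[OF rel2 ExA.hyps(2)]
      have f2_arr: "arr_in L ?\<Theta>2 (AVar f2) ?A2 ?B2" by (rule arr_in.AVar) simp
      have eq: "eqn ?\<Theta>2 ?H2 ?A2 ?B2 (AVar f2) ?t"
        using ctx2 f2_arr arr_in_append[OF t] by (simp add: eqn_def sprov_Hyp)
      have "arr_in L ?\<Theta>2 (lift c A) ?A1 ?A2" using inv2 by (simp add: inverse_pair_def)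
      then have "eqn ?\<Theta>2 ?H2 ?A1 ?B2 (Comp (AVar f2) (lift c A)) (Comp ?t (lift c A))"
        using eq ctx2 by (blast intro: eqn_Comp eqn_refl)
      also have "eqn ?\<Theta>2 ?H2 ?A1 ?B2 \<dots> (Comp (lift c B) (AVar f1))"
        using inverse_pair_sym[OF inv2(1)] arr_in_append[OF f1_lift] by (rule eqn_cancel_right)
      finally have sq: "eqn ?\<Theta>2 ?H2 ?A1 ?B2 (Comp (AVar f2) (lift c A)) (Comp (lift c B) (AVar f1))" .
      have "sprov L T ?\<Theta>2 ?H2 (Imp (aopen 0 (AVar f1) (rename r1 s1 P)) (aopen 0 (AVar f2) (rename r2 s2 P)))"
        unfolding rename_aopen_fresh[OF f(2), symmetric]
      proof (rule ExA.IH[OF f(1)])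
        show "is_ctx L (\<Psi> @ [Arr f A B])" using ExA.prems(1) ExA.hyps f by (simp add: is_ctx_snoc)
        \<comment> \<open>The hypothesis about the witness \<open>f1\<close> is itself an opened
          body; it appears here in the form that \<open>rename_aopen_fresh\<close> gives it, and is
          brought back below.\<close>
        show "ctx_rel (\<Psi> @ [Arr f A B]) ?\<Theta>2
            (insert (Eq (AVar f2) ?t) (insert (rename r1 (s1(f := f1)) (aopen 0 (AVar f) P)) (insert ?P1 H)))
            r1 (s1(f := f1)) r2 (s2(f := f2)) c c'"
          unfolding rename_aopen_fresh[OF f(2)]
          using rel2 f(1) ExA.hyps(1,2) _ _ sq by (rule ctx_rel_Arr) auto
      qed
      moreover have "sprov L T ?\<Theta>2 ?H2 (aopen 0 (AVar f1) (rename r1 s1 P))"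
        by (rule sprov_Hyp) simp
      ultimately have "sprov L T ?\<Theta>2 ?H2 (aopen 0 (AVar f2) (rename r2 s2 P))" by (rule sprov_ImpE)
      moreover have "fm_in L ?\<Theta>2 (ExA ?A2 ?B2 (rename r2 s2 P))"
        using fm(2) unfolding rename.simps by (intro fm_in_append)
      ultimately have "sprov L T ?\<Theta>2 ?H2 (ExA ?A2 ?B2 (rename r2 s2 P))"
        using f2_arr by (intro sprov_ExAI[where u = "AVar f2"])
      then show "sprov L T ?\<Theta>2 ?H2 ?P2" by (simp only: rename.simps)
    qed
  qed
  with fm(1) show ?case by (rule sprov_ImpI)
qed

lemma sprov_transport_Iff:
  assumes "fm_in L \<Psi> P" "is_ctx L \<Psi>" "ctx_rel \<Psi> \<Theta> H r1 s1 r2 s2 c c'"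
  shows "sprov L T \<Theta> H (Iff (rename r1 s1 P) (rename r2 s2 P))"
  unfolding Iff_def
  by (intro sprov_AndI sprov_transport[OF assms] sprov_transport[OF assms(1,2) ctx_rel_sym[OF assms(3)]])

end

section \<open>The two copies as interpretations of the extended context\<close>

lemma lift_component:
  "lift (\<lambda>x. component \<Delta> h (OVar x)) A = component \<Delta> h A"
  by (cases A) (auto simp: component_def)

text \<open>The overridden renamings move the names of \<open>\<Delta>\<close> and fix those of
  \<open>\<Gamma>\<close>. Since the two contexts share no names and sorts in
  \<open>\<Gamma>\<close> mention only names of \<open>\<Gamma>\<close>, a declaration of
  \<open>\<Gamma>\<close> is mapped to itself.\<close>

lemma copy_ctx_map:
  assumes "is_ctx L (\<Gamma> @ \<Delta>)" "set \<Gamma> \<subseteq> set \<Theta>" "set (copy_ctx \<Delta> r s) \<subseteq> set \<Theta>"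
  shows "ctx_map L (\<Gamma> @ \<Delta>) \<Theta> (override_on id r (ovars \<Delta>)) (override_on id s (avars \<Delta>))"
  unfolding ctx_map_def
proof (intro conjI ballI allI impI)
  let ?r = "override_on id r (ovars \<Delta>)" and ?s = "override_on id s (avars \<Delta>)"
  have copy: "rename_decl ?r ?s d \<in> set \<Theta>" if "d \<in> set \<Delta>" for d
    using assms(3) that by (auto simp: copy_ctx_def)
  {
    fix x assume x: "x \<in> ovars (\<Gamma> @ \<Delta>)"
    show "?r x \<in> ovars \<Theta>"
    proof (cases "x \<in> ovars \<Delta>")
      case True
      then show ?thesis using copy[of "Obj x"] by (simp add: ovars_def)
    next
      case False
      then show ?thesis using x assms(2) by (auto simp: ovars_def)
    qed
  }
  fix g A B assume g: "Arr g A B \<in> set (\<Gamma> @ \<Delta>)"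
  show "obj_in L (\<Gamma> @ \<Delta>) A" "obj_in L (\<Gamma> @ \<Delta>) B"
    using is_ctx_obj_in[OF assms(1) g] by auto
  show "Arr (?s g) (rename_obj ?r A) (rename_obj ?r B) \<in> set \<Theta>"
  proof (cases "Arr g A B \<in> set \<Delta>")
    case True
    then show ?thesis using copy by fastforce
  next
    case False
    then have g\<Gamma>: "Arr g A B \<in> set \<Gamma>" using g by simp
    then have "g \<notin> avars \<Delta>" using is_ctx_disjoint[OF assms(1)] by (auto simp: avars_def)
    moreover have "rename_obj ?r C = C" if "obj_in L \<Gamma> C" for C
      using that is_ctx_disjoint[OF assms(1)] by (auto elim!: obj_in.cases simp: override_on_def)
    ultimately show ?thesis
      using g\<Gamma> assms(2) is_ctx_obj_in[OF is_ctx_append[OF assms(1)] g\<Gamma>] by auto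
  qed
qed

text \<open>Closing over \<open>\<Gamma>\<close>, both copies and the components expresses that the
  context isomorphism is arbitrary. That the concatenation is a context makes the chosen names
  distinct within each name space.\<close>

theorem mainTheorem3:
  fixes L :: "('c, 'a) lang" and T :: "('c, 'a) fm set" and \<Gamma> \<Delta> :: "'c ctx"
    and r1 s1 r2 s2 h :: "nat \<Rightarrow> nat" and P :: "('c, 'a) fm"
  assumes "wf_lang L"
    and "is_theory L T"
    and "is_ctx L \<Gamma>"
    and "is_ctx L (\<Gamma> @ \<Delta>)"
    and "is_ctx L (\<Gamma> @ copy_ctx \<Delta> r1 s1 @ copy_ctx \<Delta> r2 s2 @ iso_ctx \<Delta> h r1 r2)"
    and "fm_in L (\<Gamma> @ \<Delta>) P"
  shows "proves L T
    (all_ctx (\<Gamma> @ copy_ctx \<Delta> r1 s1 @ copy_ctx \<Delta> r2 s2 @ iso_ctx \<Delta> h r1 r2)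
      (Imp (ctx_iso \<Delta> h r1 s1 r2 s2)
        (Iff (copy_fm \<Delta> r1 s1 P) (copy_fm \<Delta> r2 s2 P))))"
proof -
  interpret category_theory L T using assms(1,2) by unfold_locales
  let ?\<Theta> = "\<Gamma> @ copy_ctx \<Delta> r1 s1 @ copy_ctx \<Delta> r2 s2 @ iso_ctx \<Delta> h r1 r2"
  let ?I = "ctx_iso \<Delta> h r1 s1 r2 s2 :: ('c, 'a) fm"
  let ?r1 = "override_on id r1 (ovars \<Delta>)" and ?s1 = "override_on id s1 (avars \<Delta>)"
  let ?r2 = "override_on id r2 (ovars \<Delta>)" and ?s2 = "override_on id s2 (avars \<Delta>)"
  let ?c = "\<lambda>x. component \<Delta> h (OVar x) :: ('c, 'a) arr"
  let ?R = "Iff (copy_fm \<Delta> r1 s1 P) (copy_fm \<Delta> r2 s2 P)"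
  note disj = is_ctx_disjoint[OF assms(4)]
  have map1: "ctx_map L (\<Gamma> @ \<Delta>) ?\<Theta> ?r1 ?s1" and map2: "ctx_map L (\<Gamma> @ \<Delta>) ?\<Theta> ?r2 ?s2"
    using assms(4) by (auto intro!: copy_ctx_map)
  have h: "arr_in L ?\<Theta> (AVar (h x)) (OVar (r1 x)) (OVar (r2 x))" if "x \<in> ovars \<Delta>" for x
  proof (rule arr_in.AVar)
    have "Arr (h x) (OVar (r1 x)) (OVar (r2 x)) \<in> set (iso_decls h r1 r2 (Obj x) :: 'c ctx)" by simp
    with that show "Arr (h x) (OVar (r1 x)) (OVar (r2 x)) \<in> set ?\<Theta>"
      unfolding iso_ctx_def ovars_def by fastforce
  qed
  have comp: "arr_in L ?\<Theta> (component \<Delta> h A) (rename_obj ?r1 A) (rename_obj ?r2 A)"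
    if "obj_in L (\<Gamma> @ \<Delta>) A" for A
    using that
  proof cases
    case (OCon k)
    then show ?thesis by (auto simp: component_def intro: arr_in.Ident obj_in.OCon)
  next
    case (OVar x)
    then show ?thesis using h[of x] by (auto simp: component_def intro!: arr_in.Ident obj_in.OVar)
  qed
  \<comment> \<open>The isomorphism condition is written with the plain names \<open>s1\<close> and
    \<open>s2\<close>, the interpretations with the overridden ones; on arrows of
    \<open>\<Delta>\<close> they coincide.\<close>
  have arrow: "s1 g = ?s1 g \<and> s2 g = ?s2 g" if "Arr g A B \<in> set \<Delta>" for g A B
    using that by (auto simp: avars_def override_on_def)
  have fm_I: "fm_in L ?\<Theta> ?I"
    unfolding ctx_iso_def
  proof (rule fm_in_Conj)
    fix Q :: "('c, 'a) fm" assume "Q \<in> set (map (iso_condition \<Delta> h r1 s1 r2 s2) \<Delta>)"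
    then obtain d where d: "d \<in> set \<Delta>" "Q = iso_condition \<Delta> h r1 s1 r2 s2 d" by auto
    show "fm_in L ?\<Theta> Q"
    proof (cases d)
      case (Obj x)
      then show ?thesis using d h[of x] fm_in_is_iso[OF assms(5)] by (simp add: ovars_def)
    next
      case (Arr g A B)
      then have g: "Arr g A B \<in> set (\<Gamma> @ \<Delta>)" using d by simp
      have "arr_in L ?\<Theta> (AVar (?s1 g)) (rename_obj ?r1 A) (rename_obj ?r1 B)"
        "arr_in L ?\<Theta> (AVar (?s2 g)) (rename_obj ?r2 A) (rename_obj ?r2 B)"
        using map1 map2 g by (auto simp: ctx_map_def intro: arr_in.AVar)
      then show ?thesis
        using d Arr arrow[of g A B] comp is_ctx_obj_in[OF assms(4) g]
        by (auto intro!: fm_in.Eq arr_in.Comp)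
    qed
  qed
  have fm_R: "fm_in L ?\<Theta> ?R"
    using fm_in_ctx_map[OF assms(6) map1] fm_in_ctx_map[OF assms(6) map2]
    by (auto simp: Iff_def copy_fm_def intro: fm_in.And fm_in.Imp)
  have I: "sprov L T ?\<Theta> {?I} (iso_condition \<Delta> h r1 s1 r2 s2 d)" if "d \<in> set \<Delta>" for d
  proof (rule sprov_Conj)
    show "sprov L T ?\<Theta> {?I} (Conj (map (iso_condition \<Delta> h r1 s1 r2 s2) \<Delta>))"
      by (rule sprov_Hyp) (simp add: ctx_iso_def)
  qed (use that in simp)
  have "sprov L T ?\<Theta> {?I} ?R"
  \<comment> \<open>All inverses are named at once here, before the formula \<open>P\<close> is
    analysed.\<close>
  proof (rule sprov_is_iso_familyE[OF finite_ovars[of \<Delta>] assms(5) fm_R h])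
    fix x assume "x \<in> ovars \<Delta>"
    then show "sprov L T ?\<Theta> {?I} (is_iso (AVar (h x)) (OVar (r1 x)) (OVar (r2 x)))"
      using I[of "Obj x"] by (simp add: ovars_def)
  next
    fix \<Theta>' H' c'
    assume ext: "is_ctx L \<Theta>'" "set ?\<Theta> \<subseteq> set \<Theta>'" "{?I} \<subseteq> H'"
      and inv: "\<And>x. x \<in> ovars \<Delta> \<Longrightarrow>
        inverse_pair \<Theta>' H' (OVar (r1 x)) (OVar (r2 x)) (AVar (h x)) (c' x)"
    \<comment> \<open>Inverse components: the extracted inverses on \<open>\<Delta>\<close>, and
      identities on \<open>\<Gamma>\<close>, where \<open>?c\<close> is the identity as
      well.\<close>
    let ?c' = "override_on (\<lambda>x. Ident (OVar x)) c' (ovars \<Delta>)"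
    have "ctx_rel (\<Gamma> @ \<Delta>) \<Theta>' H' ?r1 ?s1 ?r2 ?s2 ?c ?c'"
      unfolding ctx_rel_def lift_component
    proof (intro conjI ballI allI impI)
      show "is_ctx L \<Theta>'" by (rule ext)
      show "ctx_map L (\<Gamma> @ \<Delta>) \<Theta>' ?r1 ?s1" "ctx_map L (\<Gamma> @ \<Delta>) \<Theta>' ?r2 ?s2"
        using ctx_map_mono[OF map1 ext(2)] ctx_map_mono[OF map2 ext(2)] by auto
    next
      fix x assume x: "x \<in> ovars (\<Gamma> @ \<Delta>)"
      show "inverse_pair \<Theta>' H' (OVar (?r1 x)) (OVar (?r2 x)) (?c x) (?c' x)"
      proof (cases "x \<in> ovars \<Delta>")
        case True
        then show ?thesis using inv by (simp add: component_def)
      next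
        case False
        then have "obj_in L \<Theta>' (OVar x)"
          using x ovars_mono[OF ext(2)] by (auto intro: obj_in.OVar)
        then show ?thesis using False inverse_pair_Ident[OF ext(1)] by (simp add: component_def)
      qed
    next
      fix g A B assume g: "Arr g A B \<in> set (\<Gamma> @ \<Delta>)"
      note AB = is_ctx_obj_in[OF assms(4) g]
      have arr: "arr_in L ?\<Theta> (AVar (?s1 g)) (rename_obj ?r1 A) (rename_obj ?r1 B)"
        "arr_in L ?\<Theta> (AVar (?s2 g)) (rename_obj ?r2 A) (rename_obj ?r2 B)"
        using map1 map2 g by (auto simp: ctx_map_def intro: arr_in.AVar)
      have "eqn ?\<Theta> {?I} (rename_obj ?r1 A) (rename_obj ?r2 B)
          (Comp (AVar (?s2 g)) (component \<Delta> h A)) (Comp (component \<Delta> h B) (AVar (?s1 g)))"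
      proof (cases "Arr g A B \<in> set \<Delta>")
        case True
        then have "sprov L T ?\<Theta> {?I}
            (Eq (Comp (AVar (?s2 g)) (component \<Delta> h A)) (Comp (component \<Delta> h B) (AVar (?s1 g))))"
          using I[OF True] arrow[OF True] by simp
        then show ?thesis
          using arr comp AB assms(5) by (auto simp: eqn_def intro: arr_in.Comp)
      next
        case False
        then have g\<Gamma>: "Arr g A B \<in> set \<Gamma>" using g by simp
        then have "g \<notin> avars \<Delta>" using disj by (auto simp: avars_def)
        \<comment> \<open>For an arrow \<open>g\<close> of \<open>\<Gamma>\<close> both
          interpretations give \<open>g\<close> itself and the components are identities, so the
          square is an instance of the unit laws.\<close>
        moreover have "rename_obj ?r1 C = C \<and> rename_obj ?r2 C = C \<and> component \<Delta> h C = (Ident C :: ('c, 'a) arr)"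
          if "obj_in L \<Gamma> C" for C
          using that disj by (auto elim!: obj_in.cases simp: component_def override_on_def)
        ultimately show ?thesis
          using arr is_ctx_obj_in[OF assms(3) g\<Gamma>] eqn_Ident_swap[OF assms(5)] by auto
      qed
      then show "eqn \<Theta>' H' (rename_obj ?r1 A) (rename_obj ?r2 B)
          (Comp (AVar (?s2 g)) (component \<Delta> h A)) (Comp (component \<Delta> h B) (AVar (?s1 g)))"
        using ext by (rule eqn_mono)
    qed
    from sprov_transport_Iff[OF assms(6,4) this] show "sprov L T \<Theta>' H' ?R"
      by (simp only: copy_fm_def)
  qed
  then have "sprov L T ?\<Theta> {} (Imp ?I ?R)" using fm_I by (intro sprov_ImpI)
  \<comment> \<open>With the isomorphism condition discharged no hypothesis is left, so stable
    provability applies at \<open>?\<Theta>\<close> itself and all its variables can be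
    generalised.\<close>
  then have "prov L T ?\<Theta> {} (Imp ?I ?R)" using assms(5) by (intro sprovD) auto
  then show ?thesis
    unfolding proves_def using prov_all_ctx[of L "[]" ?\<Theta> "Imp ?I ?R" T] assms(5) fm_I fm_R
    by (simp add: fm_in.Imp)
qed

end
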